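(* Let $\mathbf{X}\in\mathbb{R}^{n\times d_x}$, $\mathbf{Y}\in\mathbb{R}^{n\times d_y}$, $\lambda_x,\lambda_y\geq 0$, and set $\Sigma_{xx}=\mathbf{X}^{T}\mathbf{X}+\lambda_x\mathbf{I}_{d_x}$, $\Sigma_{yy}=\mathbf{Y}^{T}\mathbf{Y}+\lambda_y\mathbf{I}_{d_y}$, $\Sigma_{xy}=\mathbf{X}^{T}\mathbf{Y}$, with $\Sigma_{xx},\Sigma_{yy}$ positive definite. Let $1\le p\le \min(d_x,d_y)$, let $\mathbf{N}=\mathrm{diag}(\mu_1,\dots,\mu_p)$ with $\mu_1>\dots>\mu_p>0$, and let $\mathbb{S}_{xy}=\{(\mathbf{U},\mathbf{V})\in\mathbb{R}^{d_x\times p}\times\mathbb{R}^{d_y\times p}:\mathbf{U}^{T}\Sigma_{xx}\mathbf{U}=\mathbf{I}_p,\ \mathbf{V}^{T}\Sigma_{yy}\mathbf{V}=\mathbf{I}_p\}$. Define $f_{CCA}(\mathbf{U},\mathbf{V})=-\mathrm{Tr}(\mathbf{U}^{T}\Sigma_{xy}\mathbf{V}\mathbf{N})$ on $\mathbb{S}_{xy}$. Then a point $\mathbf{Z}=(\mathbf{U},\mathbf{V})\in\mathbb{S}_{xy}$ is a critical point of $f_{CCA}$ on $\mathbb{S}_{xy}$ if and only if the columns of $\mathbf{U}$ and $\mathbf{V}$ are coordinated left and right canonical correlation vectors, not necessarily on the same phase. Moreover, the minimizers of $f_{CCA}$ on $\mathbb{S}_{xy}$ are exactly the critical points $\mathbf{Z}$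 whose columns of $\mathbf{U}$ and $\mathbf{V}$ are coordinated left and right top-$p$ canonical correlation vectors on the same phase, and if $\sigma_1>\sigma_2>\dots>\sigma_{p+1}\geq 0$ the minimizer is unique up to the signs of the columns of $\mathbf{U}$ and $\mathbf{V}$.
   Context: $\mathbb{S}_{xy}$ is a smooth embedded submanifold of $\mathbb{R}^{(d_x+d_y)\times p}$ (product of two generalized Stiefel manifolds); a critical point is a point where the Riemannian gradient of $f_{CCA}$ vanishes (equivalently, where the differential of $f_{CCA}$ restricted to the tangent space vanishes; this does not depend on the Riemannian metric). Let $\mathbf{R}=\Sigma_{xx}^{-1/2}\Sigma_{xy}\Sigma_{yy}^{-1/2}$ with singular values $\sigma_1\geq\sigma_2\geq\dots$ (the canonical correlations). The columns $\mathbf{u}_i$ of $\mathbf{U}$ and $\mathbf{v}_i$ of $\mathbf{V}$ ($i=1,\dots,p$) are called coordinated left and right canonical correlation vectors (not necessarily on the same phase) if, writing $\tilde{\mathbf{u}}_i=\Sigma_{xx}^{1/2}\mathbf{u}_i$, $\tilde{\mathbf{v}}_i=\Sigma_{yy}^{1/2}\mathbf{v}_i$, there are reals $\beta_i$ with $\mathbf{R}\tilde{\mathbf{v}}_i=\beta_i\tilde{\mathbf{u}}_i$ and $\mathbf{R}^{T}\tilde{\mathbf{u}}_i=\beta_i\tilde{\mathbf{v}}_i$ (so $|\beta_i|$ is a singular value of $\mathbf{R}$ with left/right singular vectors $\tilde{\mathbf{u}}_i,\tilde{\mathbf{v}}_i$); a pair $(\mathbf{u}_i,\mathbf{v}_i)$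 is on the same phase if $\mathbf{u}_i^{T}\mathbf{X}^{T}\mathbf{Y}\mathbf{v}_i\geq 0$. They are top-$p$ canonical correlation vectors if the corresponding singular values $|\beta_i|$ are $\sigma_1,\dots,\sigma_p$ respectively. *)

theory Defs
  imports "HOL-Analysis.Analysis"
begin

(* Matrices are HOL-Analysis vectors of vectors: A :: real^'c^'r has rows indexed by 'r and
   columns indexed by 'c.  The dimensions n, d_x, d_y, p are the cardinalities of the finite
   index types 'n, 'dx, 'dy, 'p. *)

definition pos_def_mat :: "real^'n^'n \<Rightarrow> bool" where
  "pos_def_mat A \<longleftrightarrow> transpose A = A \<and> (\<forall>x. x \<noteq> 0 \<longrightarrow> 0 < x \<bullet> (A *v x))"

definition psd_mat :: "real^'n^'n \<Rightarrow> bool" where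
  "psd_mat A \<longleftrightarrow> transpose A = A \<and> (\<forall>x. 0 \<le> x \<bullet> (A *v x))"

definition msqrt :: "real^'n^'n \<Rightarrow> real^'n^'n" where
  "msqrt A = (THE B. psd_mat B \<and> B ** B = A)"

definition minvsqrt :: "real^'n^'n \<Rightarrow> real^'n^'n" where
  "minvsqrt A = matrix_inv (msqrt A)"

definition diagm :: "('p \<Rightarrow> real) \<Rightarrow> real^'p^'p" where
  "diagm \<mu> = (\<chi> i j. if i = j then \<mu> i else 0)"

text \<open>Singular values of R (a d_x x d_y matrix), with multiplicity, in non-increasing order:
  the nonnegative square roots of the eigenvalues of R^T R (an orthonormal eigenbasis exists
  by the spectral theorem).  This list has CARD('m) = d_y entries; when d_y > d_x the extra
  entries are 0, i.e. the genuine min(d_x,d_y) singular values padded by zeros.\<close>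
definition sing_vals :: "real^'m^'k \<Rightarrow> real list" where
  "sing_vals R = (THE L. length L = CARD('m) \<and> sorted_wrt (\<ge>) L \<and> (\<forall>x\<in>set L. 0 \<le> x) \<and>
      (\<exists>(Q::real^'m^'m) (e::'m \<Rightarrow> nat). orthogonal_matrix Q \<and> bij_betw e UNIV {..<CARD('m)} \<and>
         (\<forall>j. (transpose R ** R) *v column j Q = ((L ! e j)\<^sup>2) *s column j Q)))"

text \<open>sigma R k is the (k+1)-th largest singular value (0-based index k, so sigma R 0 = sigma_1);
  by convention it is 0 beyond the list of singular values.\<close>
definition sigma :: "real^'m^'k \<Rightarrow> nat \<Rightarrow> real" where
  "sigma R k = (if k < length (sing_vals R) then sing_vals R ! k else 0)"

definition col_pos :: "'p::{finite,linorder} \<Rightarrow> nat" where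
  "col_pos i = card {j. j < i}"

definition Sxx :: "real^'dx^'n \<Rightarrow> real \<Rightarrow> real^'dx^'dx" where
  "Sxx X lx = transpose X ** X + lx *\<^sub>R mat 1"

definition Sxy :: "real^'dx^'n \<Rightarrow> real^'dy^'n \<Rightarrow> real^'dy^'dx" where
  "Sxy X Y = transpose X ** Y"

definition Rmat :: "real^'dx^'n \<Rightarrow> real^'dy^'n \<Rightarrow> real \<Rightarrow> real \<Rightarrow> real^'dy^'dx" where
  "Rmat X Y lx ly = minvsqrt (Sxx X lx) ** Sxy X Y ** minvsqrt (Sxx Y ly)"

definition Sset :: "real^'dx^'n \<Rightarrow> real^'dy^'n \<Rightarrow> real \<Rightarrow> real \<Rightarrow> ((real^'p^'dx) \<times> (real^'p^'dy)) set" where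
  "Sset X Y lx ly = {(U, V). transpose U ** Sxx X lx ** U = mat 1 \<and> transpose V ** Sxx Y ly ** V = mat 1}"

definition fCCA :: "real^'dx^'n \<Rightarrow> real^'dy^'n \<Rightarrow> ('p \<Rightarrow> real) \<Rightarrow> ((real^'p^'dx) \<times> (real^'p^'dy)) \<Rightarrow> real" where
  "fCCA X Y \<mu> Z = - trace (transpose (fst Z) ** Sxy X Y ** snd Z ** diagm \<mu>)"

text \<open>Critical point of a function f (smooth on the ambient space) restricted to a set M:
  the differential of f vanishes on every tangent vector of M at Z, tangent vectors being the
  velocities at 0 of curves in M through Z that are differentiable at 0.\<close>
definition critical_point_on :: "('a::real_normed_vector \<Rightarrow> real) \<Rightarrow> 'a set \<Rightarrow> 'a \<Rightarrow> bool" where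
  "critical_point_on f M Z \<longleftrightarrow> Z \<in> M \<and>
     (\<forall>\<gamma> \<epsilon>. 0 < \<epsilon> \<longrightarrow> (\<forall>t. \<bar>t\<bar> < \<epsilon> \<longrightarrow> \<gamma> t \<in> M) \<longrightarrow> \<gamma> 0 = Z \<longrightarrow> \<gamma> differentiable (at 0)
        \<longrightarrow> ((f \<circ> \<gamma>) has_real_derivative 0) (at 0))"

definition minimizer_on :: "('a \<Rightarrow> real) \<Rightarrow> 'a set \<Rightarrow> 'a \<Rightarrow> bool" where
  "minimizer_on f M Z \<longleftrightarrow> Z \<in> M \<and> (\<forall>W\<in>M. f Z \<le> f W)"

definition coord_col :: "real^'dx^'n \<Rightarrow> real^'dy^'n \<Rightarrow> real \<Rightarrow> real \<Rightarrow> real^'p^'dx \<Rightarrow> real^'p^'dy \<Rightarrow> 'p \<Rightarrow> real \<Rightarrow> bool" where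
  "coord_col X Y lx ly U V i \<beta> \<longleftrightarrow>
     (let ut = msqrt (Sxx X lx) *v column i U; vt = msqrt (Sxx Y ly) *v column i V; R = Rmat X Y lx ly
      in R *v vt = \<beta> *s ut \<and> transpose R *v ut = \<beta> *s vt)"

definition coordinated :: "real^'dx^'n \<Rightarrow> real^'dy^'n \<Rightarrow> real \<Rightarrow> real \<Rightarrow> real^'p^'dx \<Rightarrow> real^'p^'dy \<Rightarrow> bool" where
  "coordinated X Y lx ly U V \<longleftrightarrow> (\<forall>i. \<exists>\<beta>. coord_col X Y lx ly U V i \<beta>)"

definition coordinated_top :: "real^'dx^'n \<Rightarrow> real^'dy^'n \<Rightarrow> real \<Rightarrow> real \<Rightarrow> real^('p::{finite,linorder})^'dx \<Rightarrow> real^('p::{finite,linorder})^'dy \<Rightarrow> bool" where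
  "coordinated_top X Y lx ly U V \<longleftrightarrow>
     (\<forall>i. \<exists>\<beta>. coord_col X Y lx ly U V i \<beta> \<and> \<bar>\<beta>\<bar> = sigma (Rmat X Y lx ly) (col_pos i))"

definition same_phase :: "real^'dx^'n \<Rightarrow> real^'dy^'n \<Rightarrow> real^'p^'dx \<Rightarrow> real^'p^'dy \<Rightarrow> bool" where
  "same_phase X Y U V \<longleftrightarrow> (\<forall>i. 0 \<le> column i U \<bullet> ((transpose X ** Y) *v column i V))"

end

(* The substitution u_i = Sxx^(1/2) U_i, v_i = Syy^(1/2) V_i turns the constraint set into pairs of
   orthonormal families and the objective into - sum_i mu_i <u_i, R v_i>.

   Rotating the family u in the plane of two orthonormal vectors a, b stays in the constraint set.
   With b orthogonal to all u_j, criticality forces R v_i into the span of u.  With a = u_i, b = u_k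
   it gives mu_i <u_k, R v_i> = mu_k <u_i, R v_k>; the same relation for the family v exchanges the
   two weights, and since mu_i^2 and mu_k^2 differ the off-diagonal entries <u_k, R v_i> vanish.

   For the minimum, Ky Fan's inequality bounds every partial sum of <u_i, R v_i> by the sum of the
   largest singular values; since the weights strictly decrease, Abel summation bounds the objective
   by - sum_i mu_i sigma_i with equality only if <u_i, R v_i> = sigma_i for every i. *)
theory Submission
  imports Defs
begin

text \<open>\<open>msqrt\<close> and \<open>sing_vals\<close> are definite descriptions, so
  existence and uniqueness must be settled before either can be used; the spectral theorem supplies
  existence. Uniqueness of the singular values comes from Ky Fan's inequality itself: applied to two
  decompositions of one map, it bounds the partial sums of each by those of the other. The
  inequality is stated for an abstract map and for families that may contain zero vectors, because
  the natural left singular vectors R q_j / s_j vanish at zero singular values. Equality in the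
  weighted bound determines only the numbers <u_i, R v_i>; that minimizers consist of singular
  vectors is read off from their criticality. Rotations are carried out on U alone: exchanging the
  two data sets transposes R and yields the relations for V.\<close>

section \<open>The spectral theorem\<close>

text \<open>The quadratic form of \<open>f\<close> attains its maximum \<open>c\<close> on the unit
  sphere of \<open>S\<close>. Then \<open>c * (y \<bullet> y) - y \<bullet> f y\<close> is
  nonnegative on \<open>S\<close> and zero at the maximizer \<open>x\<close>, so it is stationary
  there; stationarity in the direction of the residual \<open>c x - f x\<close> makes that residual
  vanish.\<close>

lemma self_adjoint_eigenvector_in_subspace:
  fixes f :: "'a::euclidean_space \<Rightarrow> 'a"
  assumes f: "linear f" and sa: "\<And>x y. f x \<bullet> y = x \<bullet> f y"
    and S: "subspace S" "f ` S \<subseteq> S" "S \<noteq> {0}"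
  obtains x c where "x \<in> S" "norm x = 1" "f x = c *\<^sub>R x"
proof -
  interpret f: linear f by fact
  define K where "K = S \<inter> sphere 0 1"
  have "compact K"
    unfolding K_def using S(1) by (intro closed_Int_compact closed_subspace compact_sphere)
  moreover have "K \<noteq> {}"
  proof -
    obtain y where y: "y \<in> S" "y \<noteq> 0" using S(1,3) subspace_0 by blast
    then have "y /\<^sub>R norm y \<in> K"
      using S(1) by (auto simp: K_def subspace_scale)
    then show ?thesis by blast
  qed
  moreover have "continuous_on K (\<lambda>x. x \<bullet> f x)"
    by (intro continuous_intros linear_continuous_on linear_conv_bounded_linear[THEN iffD1] f)
  ultimately obtain x where x: "x \<in> K" and max: "\<And>y. y \<in> K \<Longrightarrow> y \<bullet> f y \<le> x \<bullet> f x"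
    using continuous_attains_sup by metis
  define c where "c = x \<bullet> f x"
  have xx: "x \<bullet> x = 1" "x \<in> S" using x by (auto simp: K_def norm_eq_1)
  have bound: "y \<bullet> f y \<le> c * (y \<bullet> y)" if "y \<in> S" for y
  proof (cases "y = 0")
    case False
    have "y /\<^sub>R norm y \<in> K" using that False S(1) by (auto simp: K_def subspace_scale)
    from max[OF this] have "(y \<bullet> f y) / (norm y)\<^sup>2 \<le> c"
      by (simp add: c_def f.scale power2_eq_square divide_inverse mult_ac)
    then show ?thesis using False by (simp add: field_simps power2_norm_eq_inner)
  qed (simp add: f.zero)
  define w where "w = c *\<^sub>R x - f x"
  have wS: "w \<in> S" unfolding w_def using xx S by (auto intro!: subspace_diff subspace_scale)
  define a where "a = c * (w \<bullet> w) - w \<bullet> f w"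
  have ineq: "0 \<le> 2 * t * (w \<bullet> w) + t\<^sup>2 * a" for t
  proof -
    have "x + t *\<^sub>R w \<in> S" using wS xx S(1) by (auto intro!: subspace_add subspace_scale)
    from bound[OF this] have "0 \<le> c * ((x + t *\<^sub>R w) \<bullet> (x + t *\<^sub>R w)) - (x + t *\<^sub>R w) \<bullet> (f x + t *\<^sub>R f w)"
      by (simp add: f.add f.scale)
    also have "\<dots> = c * (x \<bullet> x) - x \<bullet> f x + t * (2 * c * (x \<bullet> w) - (x \<bullet> f w + w \<bullet> f x)) + t\<^sup>2 * a"
      by (simp add: a_def inner_add_left inner_add_right inner_commute algebra_simps power2_eq_square)
    also have "x \<bullet> f w + w \<bullet> f x = 2 * (w \<bullet> f x)" using sa[of x w] by (simp add: inner_commute)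
    also have "2 * c * (x \<bullet> w) - 2 * (w \<bullet> f x) = 2 * (w \<bullet> w)"
      by (simp add: w_def inner_commute algebra_simps)
    finally show ?thesis using xx by (simp add: c_def algebra_simps)
  qed
  have "w \<bullet> w = 0"
  proof (rule ccontr)
    assume "w \<bullet> w \<noteq> 0"
    then have pos: "0 < w \<bullet> w" by simp
    \<comment> \<open>Negative, and small enough that the quadratic term of \<open>ineq\<close> is
      at most half the size of the linear one; the summand 1 keeps the denominator positive when
      \<open>a\<close> is 0.\<close>
    define t where "t = - (w \<bullet> w) / (\<bar>a\<bar> + 1)"
    have t0: "t < 0" using pos by (simp add: t_def divide_neg_pos)
    have "\<bar>t\<bar> * \<bar>a\<bar> \<le> \<bar>t\<bar> * (\<bar>a\<bar> + 1)" by (simp add: algebra_simps)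
    also have "\<dots> = w \<bullet> w" using pos by (simp add: t_def abs_divide)
    finally have "\<bar>t\<bar> * (\<bar>t\<bar> * \<bar>a\<bar>) \<le> \<bar>t\<bar> * (w \<bullet> w)"
      by (rule mult_left_mono) simp
    moreover have "t\<^sup>2 * a \<le> \<bar>t\<bar> * (\<bar>t\<bar> * \<bar>a\<bar>)"
      using mult_left_mono[OF abs_ge_self[of a] zero_le_power2[of t]] by (simp add: power2_eq_square mult.assoc)
    ultimately have "t\<^sup>2 * a \<le> \<bar>t\<bar> * (w \<bullet> w)" by linarith
    with ineq[of t] have "0 \<le> t * (w \<bullet> w)" using t0 by simp
    with mult_neg_pos[OF t0 pos] show False by linarith
  qed
  then have "f x = c *\<^sub>R x" by (simp add: w_def)
  with xx show thesis by (intro that[of x c]) (auto simp: norm_eq_1)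
qed

text \<open>Invariant subspaces make induction on the dimension possible: by self-adjointness the
  orthogonal complement of an eigenvector inside \<open>S\<close> is again invariant.\<close>

lemma self_adjoint_eigenbasis:
  fixes f :: "'a::euclidean_space \<Rightarrow> 'a"
  assumes f: "linear f" and sa: "\<And>x y. f x \<bullet> y = x \<bullet> f y"
    and S: "subspace S" "f ` S \<subseteq> S"
  shows "\<exists>B. B \<subseteq> S \<and> pairwise orthogonal B \<and> (\<forall>x\<in>B. norm x = 1 \<and> (\<exists>c. f x = c *\<^sub>R x)) \<and> span B = S"
  using S
proof (induction "dim S" arbitrary: S rule: less_induct)
  case less
  show ?case
  proof (cases "S = {0}")
    case True
    then show ?thesis by (intro exI[of _ "{}"]) auto
  next
    case False
    obtain x c where x: "x \<in> S" "norm x = 1" "f x = c *\<^sub>R x"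
      by (rule self_adjoint_eigenvector_in_subspace[OF f sa less.prems False])
    have x0: "x \<noteq> 0" and xx: "x \<bullet> x = 1" using x by (auto simp: norm_eq_1)
    define T where "T = S \<inter> {y. x \<bullet> y = 0}"
    have T: "subspace T" unfolding T_def
      by (intro subspace_inter less.prems subspace_hyperplane)
    have fT: "f ` T \<subseteq> T" using less.prems(2) x by (auto simp: T_def sa[symmetric])
    have "dim T < dim S"
    proof (rule ccontr)
      assume "\<not> dim T < dim S"
      then have "T = S" using T less.prems(1)
        by (metis T_def inf_le1 not_less subspace_dim_equal)
      with x have "x \<in> T" by simp
      then show False using xx by (simp add: T_def)
    qed
    from less.hyps[OF this T fT] obtain B where
      B: "B \<subseteq> T" "pairwise orthogonal B" "\<forall>x\<in>B. norm x = 1 \<and> (\<exists>c. f x = c *\<^sub>R x)" "span B = T"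
      by blast
    have sub: "insert x B \<subseteq> S" using B(1) x(1) by (auto simp: T_def)
    have "S \<subseteq> span (insert x B)"
    proof
      fix y assume y: "y \<in> S"
      have "y - (x \<bullet> y) *\<^sub>R x \<in> span B"
        unfolding B(4) T_def using y x xx less.prems(1)
        by (auto simp: inner_diff_right intro: subspace_diff subspace_scale)
      then show "y \<in> span (insert x B)" unfolding span_breakdown_eq by blast
    qed
    then have "span (insert x B) = S"
      using sub less.prems(1) by (metis span_minimal subset_antisym)
    moreover have "pairwise orthogonal (insert x B)"
      using B(1,2) by (auto simp: pairwise_insert T_def orthogonal_def inner_commute)
    ultimately show ?thesis using sub B(3) x by (intro exI[of _ "insert x B"]) auto
  qed
qed

lemma symmetric_matrix_diagonalizable:
  fixes S :: "real^'n^'n"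
  assumes "transpose S = S"
  obtains Q :: "real^'n^'n" and c :: "'n \<Rightarrow> real"
  where "orthogonal_matrix Q" "\<And>j. S *v column j Q = c j *s column j Q"
proof -
  have "(S *v x) \<bullet> y = x \<bullet> (S *v y)" for x y
    using assms by (metis dot_lmul_matrix transpose_matrix_vector)
  from self_adjoint_eigenbasis[of "(*v) S", OF _ this subspace_UNIV]
  obtain B where B: "pairwise orthogonal B" "\<forall>x\<in>B. norm x = 1 \<and> (\<exists>c. S *v x = c *\<^sub>R x)"
    "span B = UNIV" by auto
  have "independent B"
    using B(1,2) by (intro pairwise_orthogonal_independent) auto
  then have "finite B" "card B = CARD('n)"
    using B(3) basis_card_eq_dim[of B UNIV] by (auto simp: finiteI_independent)
  then obtain g :: "'n \<Rightarrow> real^'n" where g: "bij_betw g UNIV B"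
    using finite_same_card_bij[of "UNIV :: 'n set" B] by auto
  define Q :: "real^'n^'n" where "Q = (\<chi> r j. g j $ r)"
  have col: "column j Q = g j" for j by (simp add: Q_def column_def vec_eq_iff)
  have gB: "g j \<in> B" for j using g by (auto simp: bij_betw_def)
  have "orthogonal_matrix Q"
    unfolding orthogonal_matrix_orthonormal_columns col
  proof (intro conjI allI impI)
    show "norm (g i) = 1" for i using gB B(2) by blast
    show "orthogonal (g i) (g j)" if "i \<noteq> j" for i j
      using pairwiseD[OF B(1) gB gB] g that by (auto simp: bij_betw_def inj_on_def)
  qed
  moreover have "\<exists>c. \<forall>j. S *v column j Q = c j *s column j Q"
    unfolding col scalar_mult_eq_scaleR using gB B(2) by (intro choice) blast
  ultimately show thesis using that by blast
qed

lemma orthogonal_matrix_inner_columns: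
  fixes Q :: "real^'n^'n"
  assumes "orthogonal_matrix Q"
  shows "column i Q \<bullet> column j Q = (if i = j then 1 else 0)"
  using assms by (auto simp: orthogonal_matrix_orthonormal_columns orthogonal_def norm_eq_1)

lemma orthogonal_matrix_expansion:
  fixes Q :: "real^'n^'n"
  assumes "orthogonal_matrix Q"
  shows "x = (\<Sum>j\<in>UNIV. (x \<bullet> column j Q) *\<^sub>R column j Q)"
proof -
  have "x = Q *v (transpose Q *v x)"
    using assms by (simp add: matrix_vector_mul_assoc orthogonal_matrix_def del: transpose_matrix_vector)
  also have "\<dots> = (\<Sum>j\<in>UNIV. (transpose Q *v x) $ j *s column j Q)"
    by (rule matrix_mult_sum)
  also have "(\<lambda>j. (transpose Q *v x) $ j) = (\<lambda>j. x \<bullet> column j Q)"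
    by (simp add: matrix_vector_mult_def transpose_def column_def inner_vec_def fun_eq_iff mult.commute)
  finally show ?thesis by (simp add: scalar_mult_eq_scaleR fun_eq_iff)
qed

section \<open>Positive semidefinite square roots\<close>

lemma inner_symmetric_matrix:
  fixes A :: "real^'n^'n"
  assumes "transpose A = A"
  shows "(A *v x) \<bullet> y = x \<bullet> (A *v y)"
  using assms by (metis dot_lmul_matrix transpose_matrix_vector)

text \<open>If \<open>w = B q - \<surd>c q\<close>, then \<open>B w = -\<surd>c w\<close>, which contradicts semidefiniteness unless
  \<open>w = 0\<close> or \<open>c = 0\<close>.\<close>

lemma psd_mat_sqrt_eigenvector:
  fixes B :: "real^'n^'n"
  assumes B: "psd_mat B" and q: "(B ** B) *v q = c *s q" "q \<noteq> 0"
  shows "B *v q = sqrt c *s q"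
proof -
  have sym: "transpose B = B" and pos: "0 \<le> x \<bullet> (B *v x)" for x using B by (auto simp: psd_mat_def)
  have BB: "B *v (B *v q) = c *s q" using q by (simp add: matrix_vector_mul_assoc)
  have "(B *v q) \<bullet> (B *v q) = c * (q \<bullet> q)"
    using BB by (simp add: inner_symmetric_matrix[OF sym] scalar_mult_eq_scaleR)
  moreover have "0 < q \<bullet> q" using q by simp
  ultimately have c: "0 \<le> c" by (metis inner_ge_zero zero_le_mult_iff not_le)
  define w where "w = B *v q - sqrt c *s q"
  have Bw: "B *v w = - sqrt c *s w"
    using c by (simp add: w_def matrix_vector_mult_diff_distrib BB vector_scalar_commute vec_eq_iff
        algebra_simps)
  have "w = 0"
  proof (cases "c = 0")
    case True
    then show ?thesis using \<open>(B *v q) \<bullet> (B *v q) = c * (q \<bullet> q)\<close> by (simp add: w_def)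
  next
    case False
    have "0 \<le> - sqrt c * (w \<bullet> w)" using pos[of w] by (simp add: Bw scalar_mult_eq_scaleR)
    then have "w \<bullet> w \<le> 0" using False c by (simp add: mult_le_0_iff)
    then show ?thesis by (metis inner_ge_zero inner_eq_zero_iff antisym)
  qed
  then show ?thesis by (simp add: w_def)
qed

lemma matrix_eq_on_orthogonal_columns:
  fixes A B :: "real^'n^'m" and Q :: "real^'n^'n"
  assumes "orthogonal_matrix Q" "\<And>j. A *v column j Q = B *v column j Q"
  shows "A = B"
proof -
  have "A *v x = B *v x" for x
  proof -
    have "A *v x = A *v (\<Sum>j\<in>UNIV. (x \<bullet> column j Q) *\<^sub>R column j Q)"
      using orthogonal_matrix_expansion[OF assms(1)] by metis
    also have "\<dots> = B *v (\<Sum>j\<in>UNIV. (x \<bullet> column j Q) *\<^sub>R column j Q)"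
      by (simp add: linear_sum linear_scale assms(2))
    finally show ?thesis using orthogonal_matrix_expansion[OF assms(1)] by metis
  qed
  then show ?thesis by (simp add: matrix_eq)
qed

lemma column_diagm: "column j (A ** diagm c) = c j *s column j A"
  for A :: "real^'n^'m"
  by (simp add: column_def diagm_def matrix_matrix_mult_def vec_eq_iff if_distrib[of "(*) _"] cong: if_cong)

lemma column_matrix_matrix_mult: "column j (A ** B) = A *v column j B"
  for A :: "real^'n^'m"
  by (simp add: column_def matrix_matrix_mult_def matrix_vector_mult_def vec_eq_iff)

text \<open>An orthonormal eigenbasis of \<open>A\<close> settles both halves: taking roots of the
  eigenvalues gives a square root, and \<open>psd_mat_sqrt_eigenvector\<close> prescribes every
  other one on each basis vector.\<close>

lemma psd_mat_has_sqrt: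
  fixes A :: "real^'n^'n"
  assumes A: "psd_mat A"
  shows "\<exists>!B. psd_mat B \<and> B ** B = A"
proof -
  have sym: "transpose A = A" using A by (simp add: psd_mat_def)
  obtain Q :: "real^'n^'n" and c where Q: "orthogonal_matrix Q"
    and c: "\<And>j. A *v column j Q = c j *s column j Q"
    using symmetric_matrix_diagonalizable[OF sym] by blast
  have QQ: "transpose Q ** Q = mat 1" "Q ** transpose Q = mat 1"
    using Q by (auto simp: orthogonal_matrix_def)
  have nz: "column j Q \<noteq> 0" for j using orthogonal_matrix_inner_columns[OF Q, of j j] by auto
  have cpos: "0 \<le> c j" for j
  proof -
    have "0 \<le> column j Q \<bullet> (A *v column j Q)" using A by (auto simp: psd_mat_def)
    then show ?thesis using orthogonal_matrix_inner_columns[OF Q, of j j]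
      by (simp add: c scalar_mult_eq_scaleR)
  qed
  define B where "B = Q ** diagm (\<lambda>j. sqrt (c j)) ** transpose Q"
  have BQ: "B *v column j Q = sqrt (c j) *s column j Q" for j
  proof -
    have "B ** Q = Q ** diagm (\<lambda>j. sqrt (c j))"
      by (simp add: B_def QQ flip: matrix_mul_assoc)
    then show ?thesis by (metis column_diagm column_matrix_matrix_mult)
  qed
  have "transpose (diagm d) = diagm d" for d :: "'n \<Rightarrow> real"
    by (auto simp: diagm_def transpose_def vec_eq_iff)
  then have "transpose B = B" by (simp add: B_def matrix_transpose_mul matrix_mul_assoc)
  moreover have "0 \<le> x \<bullet> (B *v x)" for x
  proof -
    \<comment> \<open>The coordinates of \<open>x\<close> in the eigenbasis, in which the quadratic
      form is diagonal.\<close>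
    define y where "y = transpose Q *v x"
    have "x \<bullet> (B *v x) = y \<bullet> (diagm (\<lambda>j. sqrt (c j)) *v y)"
      unfolding y_def B_def
      by (metis dot_lmul_matrix matrix_vector_mul_assoc transpose_matrix_vector)
    also have "\<dots> = (\<Sum>j\<in>UNIV. sqrt (c j) * (y $ j)\<^sup>2)"
      by (simp add: inner_vec_def diagm_def matrix_vector_mult_def mult_delta_left mult_delta_right
          power2_eq_square mult_ac)
    also have "0 \<le> \<dots>" using cpos by (intro sum_nonneg) simp
    finally show ?thesis .
  qed
  ultimately have "psd_mat B" by (simp add: psd_mat_def)
  moreover have "B ** B = A"
    using cpos by (intro matrix_eq_on_orthogonal_columns[OF Q])
      (simp add: c BQ vector_scalar_commute flip: matrix_vector_mul_assoc)
  moreover have "B' = B" if "psd_mat B'" "B' ** B' = A" for B'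
    using that psd_mat_sqrt_eigenvector[OF that(1) _ nz] c
    by (intro matrix_eq_on_orthogonal_columns[OF Q]) (simp add: BQ)
  ultimately show ?thesis by blast
qed

lemma msqrt_pos_def:
  fixes A :: "real^'n^'n"
  assumes A: "pos_def_mat A"
  shows "transpose (msqrt A) = msqrt A" "msqrt A ** msqrt A = A"
    and "minvsqrt A ** msqrt A = mat 1" "msqrt A ** minvsqrt A = mat 1"
    and "transpose (minvsqrt A) = minvsqrt A"
proof -
  have "0 \<le> x \<bullet> (A *v x)" for x
    using A by (cases "x = 0") (auto simp: pos_def_mat_def less_imp_le)
  then have "psd_mat A" using A by (simp add: psd_mat_def pos_def_mat_def)
  from theI'[OF psd_mat_has_sqrt[OF this]]
  have m: "psd_mat (msqrt A)" "msqrt A ** msqrt A = A" by (auto simp: msqrt_def)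
  then show sym: "transpose (msqrt A) = msqrt A" "msqrt A ** msqrt A = A" by (auto simp: psd_mat_def)
  have "x = 0" if "msqrt A *v x = 0" for x
  proof (rule ccontr)
    assume "x \<noteq> 0"
    then have "0 < x \<bullet> (A *v x)" using A by (auto simp: pos_def_mat_def)
    moreover have "A *v x = 0" using that m(2) by (metis matrix_vector_mul_assoc matrix_vector_mult_0_right)
    ultimately show False by simp
  qed
  then have "invertible (msqrt A)"
    unfolding invertible_left_inverse matrix_left_invertible_ker by blast
  then obtain B where "msqrt A ** B = mat 1 \<and> B ** msqrt A = mat 1" by (auto simp: invertible_def)
  then have "msqrt A ** minvsqrt A = mat 1 \<and> minvsqrt A ** msqrt A = mat 1"
    unfolding minvsqrt_def matrix_inv_def by (rule someI)
  then show inv: "minvsqrt A ** msqrt A = mat 1" "msqrt A ** minvsqrt A = mat 1" by auto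
  have "transpose (minvsqrt A) = transpose (minvsqrt A) ** (msqrt A ** minvsqrt A)"
    by (simp add: inv)
  also have "\<dots> = transpose (msqrt A ** minvsqrt A) ** minvsqrt A"
    by (simp add: matrix_transpose_mul sym matrix_mul_assoc)
  finally show "transpose (minvsqrt A) = minvsqrt A" by (simp add: inv)
qed

section \<open>Majorization by singular values\<close>

definition orthonormal_on :: "'i set \<Rightarrow> ('i \<Rightarrow> 'a::real_inner) \<Rightarrow> bool" where
  "orthonormal_on I u \<longleftrightarrow> (\<forall>i\<in>I. \<forall>j\<in>I. u i \<bullet> u j = (if i = j then 1 else 0))"

text \<open>Zero vectors are allowed so that normalised images of singular vectors, which vanish for
  the singular value \<open>0\<close>, are covered.\<close>

definition suborthonormal_on :: "'i set \<Rightarrow> ('i \<Rightarrow> 'a::real_inner) \<Rightarrow> bool" where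
  "suborthonormal_on I u \<longleftrightarrow> (\<forall>i\<in>I. \<forall>j\<in>I. i \<noteq> j \<longrightarrow> u i \<bullet> u j = 0) \<and> (\<forall>i\<in>I. u i \<bullet> u i \<le> 1)"

lemma orthonormal_onD: "orthonormal_on I u \<Longrightarrow> i \<in> I \<Longrightarrow> j \<in> I \<Longrightarrow> u i \<bullet> u j = (if i = j then 1 else 0)"
  by (auto simp: orthonormal_on_def)

lemma orthonormal_imp_suborthonormal: "orthonormal_on I u \<Longrightarrow> suborthonormal_on I u"
  by (auto simp: orthonormal_on_def suborthonormal_on_def)

lemma suborthonormal_on_subset: "suborthonormal_on I u \<Longrightarrow> J \<subseteq> I \<Longrightarrow> suborthonormal_on J u"
  by (auto simp: suborthonormal_on_def)

text \<open>Since the norms are at most one, \<open>y\<close> below satisfies |y|^2 <= <x, y>;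
  expanding |x - y|^2 >= 0 then gives <x, y> <= |x|^2.\<close>

lemma bessel_inequality:
  assumes fin: "finite I" and u: "suborthonormal_on I u"
  shows "(\<Sum>i\<in>I. (u i \<bullet> x)\<^sup>2) \<le> x \<bullet> x"
proof -
  define y where "y = (\<Sum>i\<in>I. (u i \<bullet> x) *\<^sub>R u i)"
  have xy: "x \<bullet> y = (\<Sum>i\<in>I. (u i \<bullet> x)\<^sup>2)"
    by (simp add: y_def inner_sum_right power2_eq_square inner_commute)
  have uy: "u i \<bullet> y = (u i \<bullet> x) * (u i \<bullet> u i)" if "i \<in> I" for i
  proof -
    have "u i \<bullet> y = (\<Sum>j\<in>I. if j = i then (u i \<bullet> x) * (u i \<bullet> u i) else 0)"
      unfolding y_def inner_sum_right using u that
      by (intro sum.cong) (auto simp: suborthonormal_on_def)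
    then show ?thesis using fin that by simp
  qed
  have "y \<bullet> y = (\<Sum>i\<in>I. (u i \<bullet> x) * (u i \<bullet> y))"
    by (simp add: y_def inner_sum_left)
  also have "\<dots> = (\<Sum>i\<in>I. (u i \<bullet> x)\<^sup>2 * (u i \<bullet> u i))"
    by (intro sum.cong) (auto simp: uy power2_eq_square)
  also have "\<dots> \<le> (\<Sum>i\<in>I. (u i \<bullet> x)\<^sup>2)"
    using u by (intro sum_mono mult_left_le) (auto simp: suborthonormal_on_def)
  finally have "y \<bullet> y \<le> x \<bullet> y" by (simp add: xy)
  moreover have "0 \<le> (x - y) \<bullet> (x - y)" by simp
  ultimately have "x \<bullet> y \<le> x \<bullet> x" by (simp add: inner_diff_left inner_diff_right inner_commute)
  then show ?thesis by (simp add: xy)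
qed

text \<open>Subtracting the threshold \<open>s k\<close> makes the terms before \<open>k\<close>
  nonnegative and the others nonpositive, so weight 1 before \<open>k\<close> and 0 afterwards is
  optimal. Undoing the shift costs at most \<open>s k * k\<close>, by the bound on the total
  weight.\<close>

lemma weighted_sum_le_sum_largest:
  fixes s w :: "nat \<Rightarrow> real"
  assumes dec: "decseq s" and pos: "\<And>j. 0 \<le> s j"
    and w: "\<And>j. j < d \<Longrightarrow> 0 \<le> w j" "\<And>j. j < d \<Longrightarrow> w j \<le> 1" "(\<Sum>j<d. w j) \<le> real k"
  shows "(\<Sum>j<d. s j * w j) \<le> (\<Sum>j<k. s j)"
proof -
  have "(s j - s k) * w j \<le> (if j < k then s j - s k else 0)" if "j < d" for j
  proof (cases "j < k")
    case True
    then have "0 \<le> s j - s k" using dec by (simp add: decseq_def)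
    then show ?thesis using True w(2)[OF that] by (simp add: mult_left_le)
  next
    case False
    then have "s j - s k \<le> 0" using dec by (simp add: decseq_def)
    then show ?thesis using False w(1)[OF that] by (simp add: mult_nonpos_nonneg)
  qed
  then have "(\<Sum>j<d. (s j - s k) * w j) \<le> (\<Sum>j<d. if j < k then s j - s k else 0)"
    by (intro sum_mono) auto
  also have "\<dots> = (\<Sum>j\<in>{..<d} \<inter> {..<k}. s j - s k)"
    by (simp add: sum.inter_restrict lessThan_def)
  \<comment> \<open>If \<open>d < k\<close>, the indices from \<open>d\<close> on are added; their
    terms are nonnegative because \<open>s\<close> decreases.\<close>
  also have "\<dots> \<le> (\<Sum>j<k. s j - s k)"
    using dec by (intro sum_mono2) (auto simp: decseq_def)
  finally have "(\<Sum>j<d. (s j - s k) * w j) \<le> (\<Sum>j<k. s j - s k)" .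
  moreover have "(\<Sum>j<d. (s j - s k) * w j) = (\<Sum>j<d. s j * w j) - s k * (\<Sum>j<d. w j)"
    by (simp add: left_diff_distrib sum_subtractf sum_distrib_left)
  moreover have "(\<Sum>j<k. s j - s k) = (\<Sum>j<k. s j) - s k * real k"
    by (simp add: sum_subtractf)
  moreover have "s k * (\<Sum>j<d. w j) \<le> s k * real k"
    using w(3) pos by (intro mult_left_mono)
  ultimately show ?thesis by linarith
qed

text \<open>A singular value decomposition given by its right singular vectors \<open>q\<close> and
  its values \<open>s\<close>, padded with zeros. Left vectors are derived rather than stored, since
  kernel vectors determine none.\<close>

locale singular_system =
  fixes R :: "'b::euclidean_space \<Rightarrow> 'a::euclidean_space" and s :: "nat \<Rightarrow> real" and q :: "nat \<Rightarrow> 'b"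
  assumes linear: "linear R"
    and decseq: "decseq s" and nonneg: "0 \<le> s j"
    and zero: "DIM('b) \<le> j \<Longrightarrow> s j = 0"
    and orthonormal: "orthonormal_on {..<DIM('b)} q"
    and expansion: "x = (\<Sum>j<DIM('b). (x \<bullet> q j) *\<^sub>R q j)"
    and images: "i < DIM('b) \<Longrightarrow> j < DIM('b) \<Longrightarrow> R (q i) \<bullet> R (q j) = (if i = j then (s i)\<^sup>2 else 0)"
begin

text \<open>The left singular vectors; as \<open>inverse 0 = 0\<close>, those belonging to the value
  0 are zero vectors.\<close>

definition p :: "nat \<Rightarrow> 'a" where
  "p j = R (q j) /\<^sub>R s j"

lemma R_q: "j < DIM('b) \<Longrightarrow> R (q j) = s j *\<^sub>R p j"
  using images[of j j] by (cases "s j = 0") (auto simp: p_def)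

lemma p_inner: "i < DIM('b) \<Longrightarrow> j < DIM('b) \<Longrightarrow> p i \<bullet> p j = (if i = j \<and> s i \<noteq> 0 then 1 else 0)"
  using images[of i j] by (auto simp: p_def power2_eq_square field_simps)

lemma p_suborthonormal: "suborthonormal_on {..<DIM('b)} p"
  by (auto simp: suborthonormal_on_def p_inner)

lemma parseval: "(\<Sum>j<DIM('b). (x \<bullet> q j)\<^sup>2) = x \<bullet> x"
proof -
  have "x \<bullet> x = x \<bullet> (\<Sum>j<DIM('b). (x \<bullet> q j) *\<^sub>R q j)"
    by (rule arg_cong[OF expansion])
  also have "\<dots> = (\<Sum>j<DIM('b). (x \<bullet> q j)\<^sup>2)"
    by (simp add: inner_sum_right power2_eq_square)
  finally show ?thesis by (rule sym)
qed

lemma R_expansion: "R x = (\<Sum>j<DIM('b). (s j * (x \<bullet> q j)) *\<^sub>R p j)"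
proof -
  have "R x = R (\<Sum>j<DIM('b). (x \<bullet> q j) *\<^sub>R q j)"
    using expansion[of x] by metis
  also have "\<dots> = (\<Sum>j<DIM('b). (x \<bullet> q j) *\<^sub>R R (q j))"
    by (simp add: linear linear_sum linear_scale)
  also have "\<dots> = (\<Sum>j<DIM('b). (s j * (x \<bullet> q j)) *\<^sub>R p j)"
    by (intro sum.cong) (auto simp: R_q mult.commute)
  finally show ?thesis .
qed

text \<open>A Ky Fan inequality: by AM-GM the bilinear sum is at most a weighted sum of the singular
  values whose weights are at most \<open>1\<close> and sum up to at most \<open>card I\<close>, by Bessel's inequality.\<close>

lemma ky_fan:
  assumes fin: "finite I" and u: "suborthonormal_on I u" and v: "suborthonormal_on I v"
  shows "(\<Sum>i\<in>I. u i \<bullet> R (v i)) \<le> (\<Sum>j<card I. s j)"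
proof -
  define w where "w j = (\<Sum>i\<in>I. ((v i \<bullet> q j)\<^sup>2 + (u i \<bullet> p j)\<^sup>2) / 2)" for j
  have w_eq: "w j = ((\<Sum>i\<in>I. (v i \<bullet> q j)\<^sup>2) + (\<Sum>i\<in>I. (u i \<bullet> p j)\<^sup>2)) / 2" for j
    by (simp add: w_def sum.distrib flip: sum_divide_distrib)
  have "(\<Sum>i\<in>I. u i \<bullet> R (v i)) = (\<Sum>i\<in>I. \<Sum>j<DIM('b). s j * ((v i \<bullet> q j) * (u i \<bullet> p j)))"
    by (simp add: R_expansion inner_sum_right mult.assoc)
  also have "\<dots> = (\<Sum>j<DIM('b). s j * (\<Sum>i\<in>I. (v i \<bullet> q j) * (u i \<bullet> p j)))"
    by (subst sum.swap) (simp add: sum_distrib_left)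
  also have "\<dots> \<le> (\<Sum>j<DIM('b). s j * w j)"
  proof (intro sum_mono mult_left_mono nonneg)
    fix j
    have "a * b \<le> (a\<^sup>2 + b\<^sup>2) / 2" for a b :: real
      using sum_squares_bound[of a b] by simp
    then show "(\<Sum>i\<in>I. (v i \<bullet> q j) * (u i \<bullet> p j)) \<le> w j"
      unfolding w_def by (intro sum_mono)
  qed
  also have "\<dots> \<le> (\<Sum>j<card I. s j)"
  proof (rule weighted_sum_le_sum_largest[OF decseq nonneg])
    fix j assume j: "j < DIM('b)"
    show "0 \<le> w j" unfolding w_def by (intro sum_nonneg) simp
    have "(\<Sum>i\<in>I. (v i \<bullet> q j)\<^sup>2) \<le> 1"
      using bessel_inequality[OF fin v, of "q j"] orthonormal_onD[OF orthonormal] j by simp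
    moreover have "p j \<bullet> p j \<le> 1" using j by (simp add: p_inner)
    then have "(\<Sum>i\<in>I. (u i \<bullet> p j)\<^sup>2) \<le> 1"
      using bessel_inequality[OF fin u, of "p j"] by linarith
    ultimately show "w j \<le> 1" by (simp add: w_eq)
  next
    \<comment> \<open>Summing over \<open>j\<close> first leaves one contribution per
      \<open>i\<close>: Parseval for \<open>q\<close> and Bessel for \<open>p\<close> bound each of
      its two halves by 1/2.\<close>
    have "(\<Sum>j<DIM('b). w j) = (\<Sum>i\<in>I. ((\<Sum>j<DIM('b). (v i \<bullet> q j)\<^sup>2) + (\<Sum>j<DIM('b). (u i \<bullet> p j)\<^sup>2)) / 2)"
      unfolding w_def by (subst sum.swap) (simp add: sum.distrib flip: sum_divide_distrib)
    also have "\<dots> \<le> (\<Sum>i\<in>I. 1)"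
    proof (intro sum_mono)
      fix i assume i: "i \<in> I"
      have "(\<Sum>j<DIM('b). (u i \<bullet> p j)\<^sup>2) \<le> u i \<bullet> u i"
        using bessel_inequality[OF _ p_suborthonormal, of "u i"] by (simp add: inner_commute)
      moreover have "u i \<bullet> u i \<le> 1" "v i \<bullet> v i \<le> 1"
        using u v i by (auto simp: suborthonormal_on_def)
      ultimately show "((\<Sum>j<DIM('b). (v i \<bullet> q j)\<^sup>2) + (\<Sum>j<DIM('b). (u i \<bullet> p j)\<^sup>2)) / 2 \<le> 1"
        by (simp add: parseval)
    qed
    finally show "(\<Sum>j<DIM('b). w j) \<le> real (card I)" by simp
  qed
  finally show ?thesis .
qed

text \<open>Replaces the zero vectors among the \<open>p j\<close> by unit vectors orthogonal to the
  earlier ones, for which \<open>m\<close> must not exceed the dimension of the target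
  space.\<close>

lemma exists_left_singular_vectors:
  "m \<le> DIM('a) \<Longrightarrow> m \<le> DIM('b) \<Longrightarrow>
    \<exists>r. orthonormal_on {..<m} r \<and> (\<forall>j<m. R (q j) = s j *\<^sub>R r j)"
proof (induction m)
  case 0
  then show ?case by (simp add: orthonormal_on_def)
next
  case (Suc m)
  then obtain r where r: "orthonormal_on {..<m} r" "\<And>j. j < m \<Longrightarrow> R (q j) = s j *\<^sub>R r j" by auto
  have "\<exists>x. x \<bullet> x = 1 \<and> (\<forall>j<m. x \<bullet> r j = 0) \<and> R (q m) = s m *\<^sub>R x"
  proof (cases "s m = 0")
    case True
    have "dim (r ` {..<m}) \<le> m"
      by (metis card_image_le card_lessThan dim_le_card' finite_imageI finite_lessThan le_trans)
    then have "dim (r ` {..<m}) < DIM('a)" using Suc.prems by simp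
    then obtain x where x: "x \<noteq> 0" "\<And>y. y \<in> span (r ` {..<m}) \<Longrightarrow> orthogonal x y"
      using orthogonal_to_subspace_exists by blast
    have "x \<bullet> r j = 0" if "j < m" for j
      using x(2)[of "r j"] that by (auto simp: span_base orthogonal_def)
    moreover have "norm (x /\<^sub>R norm x) = 1" using x(1) by simp
    then have "(x /\<^sub>R norm x) \<bullet> (x /\<^sub>R norm x) = 1" unfolding norm_eq_1 .
    ultimately show ?thesis using True Suc.prems R_q[of m]
      by (intro exI[of _ "x /\<^sub>R norm x"]) auto
  next
    case False
    \<comment> \<open>Zero values come last in a decreasing sequence, so no filler has been used yet
      and \<open>p m\<close> is orthogonal to all earlier vectors.\<close>
    have "r j = p j" if "j < m" for j
    proof -
      have "s m \<le> s j" using decseq that by (simp add: decseq_def)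
      then have "s j \<noteq> 0" using False nonneg[of m] by linarith
      then show ?thesis using r(2)[OF that] by (simp add: p_def)
    qed
    then show ?thesis using False Suc.prems
      by (intro exI[of _ "p m"]) (auto simp: p_inner R_q)
  qed
  then obtain x where "x \<bullet> x = 1" "\<forall>j<m. x \<bullet> r j = 0" "R (q m) = s m *\<^sub>R x" by blast
  then show ?case using r
    by (intro exI[of _ "r(m := x)"]) (auto simp: orthonormal_on_def less_Suc_eq inner_commute)
qed

text \<open>Assumption \<open>ev\<close> is the weak form of R^T R x = s_i^2 x. Testing it against
  \<open>q j\<close> gives (s_j^2 - s_i^2) <x, q_j> = 0, so only the component along
  \<open>q i\<close> survives.\<close>

lemma simple_right_singular_vector:
  assumes i: "i < DIM('b)" and simple: "\<And>j. j < DIM('b) \<Longrightarrow> j \<noteq> i \<Longrightarrow> s j \<noteq> s i"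
    and ev: "\<And>y. R x \<bullet> R y = (s i)\<^sup>2 * (x \<bullet> y)"
  shows "x = (x \<bullet> q i) *\<^sub>R q i"
proof -
  have 0: "x \<bullet> q j = 0" if j: "j < DIM('b)" "j \<noteq> i" for j
  proof -
    have "R x \<bullet> R (q j) = (\<Sum>l<DIM('b). (s l * (x \<bullet> q l)) * (p l \<bullet> (s j *\<^sub>R p j)))"
      by (simp add: R_expansion[of x] R_q j inner_sum_left sum_distrib_left mult_ac)
    also have "\<dots> = (\<Sum>l<DIM('b). if l = j then (s j)\<^sup>2 * (x \<bullet> q j) else 0)"
      using j by (intro sum.cong) (auto simp: p_inner power2_eq_square)
    also have "\<dots> = (s j)\<^sup>2 * (x \<bullet> q j)" using j by simp
    finally have "((s j)\<^sup>2 - (s i)\<^sup>2) * (x \<bullet> q j) = 0" by (auto simp: ev)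
    moreover have "(s j)\<^sup>2 \<noteq> (s i)\<^sup>2" using simple[OF j] nonneg by (metis power2_eq_iff_nonneg)
    ultimately show ?thesis by simp
  qed
  have "x = (\<Sum>j<DIM('b). (x \<bullet> q j) *\<^sub>R q j)" by (rule expansion)
  also have "\<dots> = (\<Sum>j<DIM('b). if j = i then (x \<bullet> q i) *\<^sub>R q i else 0)"
    using 0 by (intro sum.cong) auto
  finally show ?thesis using i by simp
qed

end

text \<open>Ky Fan's inequality of the second system, evaluated at the singular vectors of the
  first. Vanishing left vectors do no harm there, since they still pair to the value 0.\<close>

lemma singular_system_sums_le:
  fixes R :: "'b::euclidean_space \<Rightarrow> 'a::euclidean_space"
  assumes "singular_system R s q" "singular_system R s' q'" "k \<le> DIM('b)"
  shows "(\<Sum>j<k. s j) \<le> (\<Sum>j<k. s' j)"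
proof -
  interpret A: singular_system R s q by fact
  interpret B: singular_system R s' q' by fact
  have sub: "{..<k} \<subseteq> {..<DIM('b)}" using assms(3) by auto
  have "A.p j \<bullet> R (q j) = s j" if "j < k" for j
    using that assms(3) by (simp add: A.R_q A.p_inner)
  then have "(\<Sum>j<k. s j) = (\<Sum>j<k. A.p j \<bullet> R (q j))" by simp
  also have "\<dots> \<le> (\<Sum>j<card {..<k}. s' j)"
    using suborthonormal_on_subset[OF A.p_suborthonormal sub]
      suborthonormal_on_subset[OF orthonormal_imp_suborthonormal[OF A.orthonormal] sub]
    by (intro B.ky_fan) auto
  finally show ?thesis by simp
qed

lemma singular_system_unique:
  fixes R :: "'b::euclidean_space \<Rightarrow> 'a::euclidean_space"
  assumes "singular_system R s q" "singular_system R s' q'"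
  shows "s = s'"
proof
  fix k
  show "s k = s' k"
  proof (cases "k < DIM('b)")
    case True
    have "(\<Sum>j<m. s j) = (\<Sum>j<m. s' j)" if "m \<le> DIM('b)" for m
      using singular_system_sums_le[OF assms that] singular_system_sums_le[OF assms(2,1) that] by linarith
    from this[of k] this[of "Suc k"] True show ?thesis by simp
  next
    case False
    then show ?thesis using assms by (auto simp: singular_system_def)
  qed
qed

section \<open>Strictly decreasing weights\<close>

text \<open>Abel summation as an induction that removes the largest index \<open>b\<close>, the one
  with the smallest weight. The baseline \<open>c\<close> is general because it rises to
  \<open>\<mu> b\<close> in the induction hypothesis; what remains is \<open>\<mu> b - c\<close>
  times the total sum.\<close>

lemma strictly_weighted_sum_nonneg:
  fixes \<mu> x :: "'p::linorder \<Rightarrow> real"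
  assumes "finite A"
    and "\<And>i j. i \<in> A \<Longrightarrow> j \<in> A \<Longrightarrow> i < j \<Longrightarrow> \<mu> j < \<mu> i" and "\<And>i. i \<in> A \<Longrightarrow> c < \<mu> i"
    and "\<And>i. i \<in> A \<Longrightarrow> 0 \<le> (\<Sum>j\<in>{j\<in>A. j \<le> i}. x j)"
  shows "0 \<le> (\<Sum>i\<in>A. (\<mu> i - c) * x i) \<and> ((\<Sum>i\<in>A. (\<mu> i - c) * x i) = 0 \<longrightarrow> (\<forall>i\<in>A. x i = 0))"
  using assms
proof (induction A arbitrary: c rule: finite_linorder_max_induct)
  case (insert b A)
  have b: "b \<notin> A" using insert.hyps by auto
  have partial: "0 \<le> (\<Sum>j\<in>{j\<in>A. j \<le> i}. x j)" if "i \<in> A" for i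
  proof -
    have "{j \<in> insert b A. j \<le> i} = {j\<in>A. j \<le> i}" using insert.hyps(2) that by force
    then show ?thesis using insert.prems(3)[of i] that by simp
  qed
  have "0 \<le> (\<Sum>i\<in>A. (\<mu> i - \<mu> b) * x i) \<and>
      ((\<Sum>i\<in>A. (\<mu> i - \<mu> b) * x i) = 0 \<longrightarrow> (\<forall>i\<in>A. x i = 0))"
  proof (rule insert.IH[OF _ _ partial])
    show "\<mu> j < \<mu> i" if "i \<in> A" "j \<in> A" "i < j" for i j
      using insert.prems(1)[of i j] that by simp
    show "\<mu> b < \<mu> i" if "i \<in> A" for i
      using insert.prems(1)[of i b] insert.hyps(2) that by simp
  qed
  then have IH: "0 \<le> (\<Sum>i\<in>A. (\<mu> i - \<mu> b) * x i)"
    "(\<Sum>i\<in>A. (\<mu> i - \<mu> b) * x i) = 0 \<longrightarrow> (\<forall>i\<in>A. x i = 0)" by blast+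
  have "{j \<in> insert b A. j \<le> b} = insert b A" using insert.hyps(2) by auto
  then have total: "0 \<le> (\<Sum>j\<in>insert b A. x j)" using insert.prems(3)[of b] by simp
  have c: "0 < \<mu> b - c" using insert.prems(2) by simp
  have split: "(\<Sum>i\<in>insert b A. (\<mu> i - c) * x i)
      = (\<Sum>i\<in>A. (\<mu> i - \<mu> b) * x i) + (\<mu> b - c) * (\<Sum>j\<in>insert b A. x j)"
  proof -
    have "(\<Sum>i\<in>A. (\<mu> i - c) * x i) = (\<Sum>i\<in>A. (\<mu> i - \<mu> b) * x i + (\<mu> b - c) * x i)"
      by (intro sum.cong) (auto simp: algebra_simps)
    then show ?thesis using b insert.hyps(1)
      by (simp add: sum.distrib sum_distrib_left distrib_left)
  qed
  have nonneg: "0 \<le> (\<mu> b - c) * (\<Sum>j\<in>insert b A. x j)" using c total by simp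
  show ?case
  proof (intro conjI impI)
    show "0 \<le> (\<Sum>i\<in>insert b A. (\<mu> i - c) * x i)" unfolding split using IH(1) nonneg by linarith
    assume "(\<Sum>i\<in>insert b A. (\<mu> i - c) * x i) = 0"
    then have eq: "(\<Sum>i\<in>A. (\<mu> i - \<mu> b) * x i) = 0" "(\<mu> b - c) * (\<Sum>j\<in>insert b A. x j) = 0"
      unfolding split using IH(1) nonneg by linarith+
    then have "\<forall>i\<in>A. x i = 0" using IH(2) by blast
    \<comment> \<open>The total sum vanishes as \<open>\<mu> b - c\<close> is positive, and only
      \<open>x b\<close> is left in it.\<close>
    moreover from this eq(2) c b insert.hyps(1) have "x b = 0" by simp
    ultimately show "\<forall>i\<in>insert b A. x i = 0" by simp
  qed
qed simp

text \<open>Lets the sum of the largest singular values be indexed by an initial segment of columns.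
  Strict monotonicity gives injectivity, and counting gives surjectivity.\<close>

lemma bij_betw_col_pos:
  "bij_betw col_pos {..i} {..<card {..i}}" for i :: "'p::{finite,linorder}"
proof -
  have mono: "col_pos j < col_pos k" if "j < k" for j k :: 'p
    unfolding col_pos_def using that by (intro psubset_card_mono) auto
  have inj: "inj_on col_pos {..i}"
    by (intro linorder_inj_onI) (auto dest: mono)
  have "col_pos ` {..i} \<subseteq> {..<card {..i}}"
    unfolding col_pos_def by (auto intro!: psubset_card_mono)
  then have "col_pos ` {..i} = {..<card {..i}}"
    using inj by (intro card_subset_eq) (auto simp: card_image)
  with inj show ?thesis by (simp add: bij_betw_def)
qed

lemma col_pos_less: "col_pos i < CARD('p)" for i :: "'p::{finite,linorder}"
  unfolding col_pos_def by (intro psubset_card_mono) auto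

lemma inj_col_pos: "inj (col_pos :: 'p::{finite,linorder} \<Rightarrow> nat)"
proof (rule injI)
  fix i j :: 'p
  assume "col_pos i = col_pos j"
  then show "i = j"
    using bij_betw_col_pos[of "max i j"] by (auto simp: bij_betw_def inj_on_def)
qed

context singular_system
begin

text \<open>A single deficit \<open>x i\<close> may be negative, but Ky Fan's inequality on the
  columns up to \<open>i\<close> makes every partial sum of deficits nonnegative, which suffices for
  decreasing weights.\<close>

lemma weighted_ky_fan:
  fixes \<mu> :: "'p::{finite,linorder} \<Rightarrow> real"
  assumes \<mu>: "\<And>i j. i < j \<Longrightarrow> \<mu> j < \<mu> i" "\<And>i. 0 < \<mu> i"
    and u: "orthonormal_on UNIV u" and v: "orthonormal_on UNIV v"
  shows "(\<Sum>i\<in>UNIV. \<mu> i * (u i \<bullet> R (v i))) \<le> (\<Sum>i\<in>UNIV. \<mu> i * s (col_pos i))"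
    and "(\<Sum>i\<in>UNIV. \<mu> i * (u i \<bullet> R (v i))) = (\<Sum>i\<in>UNIV. \<mu> i * s (col_pos i))
      \<Longrightarrow> u i \<bullet> R (v i) = s (col_pos i)"
proof -
  define x where "x i = s (col_pos i) - u i \<bullet> R (v i)" for i
  have "0 \<le> (\<Sum>j\<in>{j\<in>UNIV. j \<le> i}. x j)" for i
  proof -
    have "(\<Sum>j\<in>{..i}. u j \<bullet> R (v j)) \<le> (\<Sum>j<card {..i}. s j)"
      using u v by (intro ky_fan suborthonormal_on_subset[OF orthonormal_imp_suborthonormal]) auto
    also have "\<dots> = (\<Sum>j\<in>{..i}. s (col_pos j))"
      by (rule sum.reindex_bij_betw[OF bij_betw_col_pos, symmetric])
    finally show ?thesis by (simp add: x_def sum_subtractf atMost_def)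
  qed
  then have *: "0 \<le> (\<Sum>i\<in>UNIV. (\<mu> i - 0) * x i) \<and>
    ((\<Sum>i\<in>UNIV. (\<mu> i - 0) * x i) = 0 \<longrightarrow> (\<forall>i\<in>UNIV. x i = 0))"
    using \<mu> by (intro strictly_weighted_sum_nonneg) auto
  have eq: "(\<Sum>i\<in>UNIV. (\<mu> i - 0) * x i)
      = (\<Sum>i\<in>UNIV. \<mu> i * s (col_pos i)) - (\<Sum>i\<in>UNIV. \<mu> i * (u i \<bullet> R (v i)))"
    by (simp add: x_def right_diff_distrib sum_subtractf)
  show "(\<Sum>i\<in>UNIV. \<mu> i * (u i \<bullet> R (v i))) \<le> (\<Sum>i\<in>UNIV. \<mu> i * s (col_pos i))"
    using * eq by linarith
  show "u i \<bullet> R (v i) = s (col_pos i)"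
    if "(\<Sum>i\<in>UNIV. \<mu> i * (u i \<bullet> R (v i))) = (\<Sum>i\<in>UNIV. \<mu> i * s (col_pos i))"
    using * that unfolding eq by (simp add: x_def)
qed

text \<open>Shows that the bound of \<open>weighted_ky_fan\<close> is attained.\<close>

lemma top_singular_vectors_exist:
  assumes "CARD('p::{finite,linorder}) \<le> DIM('a)" "CARD('p) \<le> DIM('b)"
  shows "\<exists>(u :: 'p \<Rightarrow> 'a) v. orthonormal_on UNIV u \<and> orthonormal_on UNIV v
    \<and> (\<forall>i. u i \<bullet> R (v i) = s (col_pos i))"
proof -
  obtain r where r: "orthonormal_on {..<CARD('p)} r" "\<forall>j<CARD('p). R (q j) = s j *\<^sub>R r j"
    using exists_left_singular_vectors[OF assms] by blast
  have "orthonormal_on UNIV (\<lambda>i::'p. r (col_pos i))"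
    using orthonormal_onD[OF r(1)] by (auto simp: orthonormal_on_def col_pos_less inj_eq[OF inj_col_pos])
  moreover have "orthonormal_on UNIV (\<lambda>i::'p. q (col_pos i))"
    using orthonormal_onD[OF orthonormal] less_le_trans[OF col_pos_less assms(2)]
    by (auto simp: orthonormal_on_def inj_eq[OF inj_col_pos])
  moreover have "r (col_pos i) \<bullet> R (q (col_pos i)) = s (col_pos i)" for i :: 'p
    using r orthonormal_onD[OF r(1), of "col_pos i" "col_pos i"] by (simp add: col_pos_less)
  ultimately show ?thesis by blast
qed

end

section \<open>Well-definedness of the list of singular values\<close>

text \<open>The indices are sorted by their values, not the values themselves, so that the position
  of an index is a bijection even when values repeat.\<close>

lemma exists_sorting_bijection:
  fixes c :: "'m::finite \<Rightarrow> 'a::linorder"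
  shows "\<exists>L e. length L = CARD('m) \<and> sorted_wrt (\<ge>) L \<and> bij_betw e UNIV {..<CARD('m)} \<and> (\<forall>j. L ! e j = c j)"
proof -
  obtain xs :: "'m list" where xs: "set xs = UNIV" "distinct xs"
    using finite_distinct_list[of "UNIV :: 'm set"] by auto
  define ys where "ys = rev (sort_key c xs)"
  have ys: "set ys = UNIV" "distinct ys" by (simp_all add: ys_def xs)
  then have len: "length ys = CARD('m)" by (metis distinct_card)
  have sorted: "sorted_wrt (\<ge>) (map c ys)"
    by (simp add: ys_def sorted_wrt_rev flip: rev_map)
  have bij: "bij_betw ((!) ys) {..<CARD('m)} UNIV"
    using bij_betw_nth[OF ys(2), of "{..<CARD('m)}" UNIV] by (simp add: len ys(1))
  define e where "e = the_inv_into {..<CARD('m)} ((!) ys)"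
  have e: "bij_betw e UNIV {..<CARD('m)}"
    unfolding e_def by (rule bij_betw_the_inv_into[OF bij])
  have "map c ys ! e j = c j" for j
  proof -
    have "e j < length ys" using e by (auto simp: bij_betw_def len)
    moreover have "ys ! e j = j"
      unfolding e_def using bij by (intro f_the_inv_into_f) (auto simp: bij_betw_def)
    ultimately show ?thesis by simp
  qed
  then show ?thesis using sorted e len by (intro exI[of _ "map c ys"] exI[of _ e]) auto
qed

text \<open>The property under the definite description in \<open>sing_vals\<close>, named so that
  existence and uniqueness can be treated separately.\<close>

definition sing_vals_spec :: "real^'m^'k \<Rightarrow> real list \<Rightarrow> bool" where
  "sing_vals_spec R L \<longleftrightarrow> length L = CARD('m) \<and> sorted_wrt (\<ge>) L \<and> (\<forall>x\<in>set L. 0 \<le> x) \<and>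
      (\<exists>(Q::real^'m^'m) (e::'m \<Rightarrow> nat). orthogonal_matrix Q \<and> bij_betw e UNIV {..<CARD('m)} \<and>
         (\<forall>j. (transpose R ** R) *v column j Q = ((L ! e j)\<^sup>2) *s column j Q))"

lemma inner_gram_matrix: "x \<bullet> ((transpose R ** R) *v y) = (R *v x) \<bullet> (R *v y)"
  for R :: "real^'m^'k"
  by (metis dot_lmul_matrix matrix_vector_mul_assoc transpose_matrix_vector transpose_transpose)

lemma sing_vals_spec_exists: "\<exists>L. sing_vals_spec R L" for R :: "real^'m^'k"
proof -
  have "transpose (transpose R ** R) = transpose R ** R" by (simp add: matrix_transpose_mul)
  then obtain Q c where Q: "orthogonal_matrix Q"
    and c: "\<And>j. (transpose R ** R) *v column j Q = c j *s column j Q"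
    using symmetric_matrix_diagonalizable by blast
  have cpos: "0 \<le> c j" for j
  proof -
    have "c j = column j Q \<bullet> ((transpose R ** R) *v column j Q)"
      using orthogonal_matrix_inner_columns[OF Q, of j j] by (simp add: c scalar_mult_eq_scaleR)
    then show ?thesis by (simp add: inner_gram_matrix)
  qed
  obtain L e where L: "length L = CARD('m)" "sorted_wrt (\<ge>) L" "bij_betw e UNIV {..<CARD('m)}"
    "\<forall>j. L ! e j = sqrt (c j)"
    using exists_sorting_bijection[of "\<lambda>j. sqrt (c j)"] by blast
  have "\<forall>x\<in>set L. 0 \<le> x"
  proof
    fix x assume "x \<in> set L"
    then obtain i where i: "i < CARD('m)" "x = L ! i" by (auto simp: in_set_conv_nth L(1))
    then obtain j where "i = e j" using L(3) by (auto simp: bij_betw_def)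
    then show "0 \<le> x" using i L(4) cpos by simp
  qed
  then have "sing_vals_spec R L"
    unfolding sing_vals_spec_def using L Q c cpos by (auto intro!: exI[of _ Q] exI[of _ e])
  then show ?thesis ..
qed

lemma sing_vals_spec_imp_singular_system:
  fixes R :: "real^'m^'k"
  assumes "sing_vals_spec R L"
  shows "\<exists>q. singular_system ((*v) R) (\<lambda>k. if k < length L then L ! k else 0) q"
proof -
  have L: "length L = CARD('m)" "sorted_wrt (\<ge>) L" "\<forall>x\<in>set L. 0 \<le> x"
    using assms by (auto simp: sing_vals_spec_def)
  obtain Q :: "real^'m^'m" and e where Q: "orthogonal_matrix Q" and e: "bij_betw e UNIV {..<CARD('m)}"
    and ev: "\<And>j. (transpose R ** R) *v column j Q = ((L ! e j)\<^sup>2) *s column j Q"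
    using assms by (auto simp: sing_vals_spec_def)
  \<comment> \<open>\<open>g\<close> inverts the enumeration \<open>e\<close>, so \<open>q i\<close>
    is an eigenvector for the \<open>i\<close>-th entry of \<open>L\<close>.\<close>
  define g where "g = the_inv_into UNIV e"
  have g: "bij_betw g {..<CARD('m)} UNIV" unfolding g_def by (rule bij_betw_the_inv_into[OF e])
  have eg: "e (g i) = i" if "i < CARD('m)" for i
    unfolding g_def using e that by (intro f_the_inv_into_f) (auto simp: bij_betw_def)
  define q where "q i = column (g i) Q" for i
  have qq: "q i \<bullet> q j = (if i = j then 1 else 0)" if "i < CARD('m)" "j < CARD('m)" for i j
    unfolding q_def orthogonal_matrix_inner_columns[OF Q] using that by (metis eg)
  have pos: "0 \<le> L ! i" if "i < length L" for i using L(3) that by simp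
  have "singular_system ((*v) R) (\<lambda>k. if k < length L then L ! k else 0) q"
  proof
    show "R *v (x + y) = R *v x + R *v y" for x y
      by (rule matrix_vector_right_distrib)
    show "R *v (c *\<^sub>R x) = c *\<^sub>R (R *v x)" for c x
      by (rule matrix_vector_mult_scaleR)
    show "decseq (\<lambda>k. if k < length L then L ! k else 0)"
      unfolding decseq_def using L(2) pos by (auto simp: sorted_wrt_iff_nth_less le_less)
    show "x = (\<Sum>j<DIM(real^'m). (x \<bullet> q j) *\<^sub>R q j)" for x
      unfolding q_def DIM_cart DIM_real mult_1_right
      using sum.reindex_bij_betw[OF g, of "\<lambda>j. (x \<bullet> column j Q) *\<^sub>R column j Q"]
        orthogonal_matrix_expansion[OF Q, of x] by simp
    show "(R *v q i) \<bullet> (R *v q j) = (if i = j then (if i < length L then L ! i else 0)\<^sup>2 else 0)"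
      if "i < DIM(real^'m)" "j < DIM(real^'m)" for i j
    proof -
      have "(R *v q i) \<bullet> (R *v q j) = (L ! e (g j))\<^sup>2 * (q i \<bullet> q j)"
        by (simp add: ev q_def scalar_mult_eq_scaleR flip: inner_gram_matrix)
      then show ?thesis using that by (auto simp: qq eg L(1))
    qed
  qed (use qq pos L(1) in \<open>auto simp: orthonormal_on_def\<close>)
  then show ?thesis by blast
qed

text \<open>Both lists, padded by zeros, are the values of singular systems of one map and hence
  coincide by \<open>singular_system_unique\<close>.\<close>

lemma sing_vals_spec_unique:
  fixes R :: "real^'m^'k"
  assumes L: "sing_vals_spec R L" and L': "sing_vals_spec R L'"
  shows "L = L'"
proof (rule nth_equalityI)
  show len: "length L = length L'" using assms by (simp add: sing_vals_spec_def)
  fix i assume i: "i < length L"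
  have "(\<lambda>k. if k < length L then L ! k else 0) = (\<lambda>k. if k < length L' then L' ! k else 0)"
    using sing_vals_spec_imp_singular_system[OF L] sing_vals_spec_imp_singular_system[OF L']
      singular_system_unique by blast
  from fun_cong[OF this, of i] i len show "L ! i = L' ! i" by simp
qed

lemma singular_system_sigma:
  fixes R :: "real^'m^'k"
  obtains q where "singular_system ((*v) R) (sigma R) q"
proof -
  have "sing_vals R = (THE L. sing_vals_spec R L)"
    by (simp add: sing_vals_def sing_vals_spec_def)
  then have "sing_vals_spec R (sing_vals R)"
    using sing_vals_spec_exists[of R] sing_vals_spec_unique[of R] by (metis theI)
  from sing_vals_spec_imp_singular_system[OF this] show thesis
    using that by (auto simp: sigma_def[abs_def])
qed

section \<open>Critical points and rotations\<close>

text \<open>\<open>G t\<close> is the rotation by the angle \<open>t\<close> in the plane of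
  \<open>a\<close> and \<open>b\<close>: \<open>P\<close> projects onto the plane, \<open>K\<close>
  projects and turns by a right angle. All inner products reduce to \<open>D\<close> and
  \<open>E\<close>, leaving cos^2 + sin^2 - 1 as the only change.\<close>

lemma rotation_preserves_inner:
  fixes a b x y :: "'a::real_inner"
  assumes "a \<bullet> a = 1" "b \<bullet> b = 1" "a \<bullet> b = 0"
  defines "G \<equiv> \<lambda>t x. x + (cos t - 1) *\<^sub>R ((a \<bullet> x) *\<^sub>R a + (b \<bullet> x) *\<^sub>R b)
    + sin t *\<^sub>R ((a \<bullet> x) *\<^sub>R b - (b \<bullet> x) *\<^sub>R a)"
  shows "G t x \<bullet> G t y = x \<bullet> y"
proof -
  define P where "P x = (a \<bullet> x) *\<^sub>R a + (b \<bullet> x) *\<^sub>R b" for x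
  define K where "K x = (a \<bullet> x) *\<^sub>R b - (b \<bullet> x) *\<^sub>R a" for x
  define D where "D = (a \<bullet> x) * (a \<bullet> y) + (b \<bullet> x) * (b \<bullet> y)"
  define E where "E = (b \<bullet> x) * (a \<bullet> y) - (a \<bullet> x) * (b \<bullet> y)"
  have ba: "b \<bullet> a = 0" using assms(3) by (simp add: inner_commute)
  have D: "x \<bullet> P y = D" "P x \<bullet> y = D" "P x \<bullet> P y = D" "K x \<bullet> K y = D"
    by (simp_all add: P_def K_def D_def inner_add_left inner_add_right inner_diff_left inner_diff_right
        assms(1-3) ba inner_commute[of x])
  have E: "x \<bullet> K y = E" "K x \<bullet> y = - E" "P x \<bullet> K y = E" "K x \<bullet> P y = - E"
    by (simp_all add: P_def K_def E_def inner_add_left inner_add_right inner_diff_left inner_diff_right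
        assms(1-3) ba inner_commute[of x])
  have expand: "(x + (c - 1) *\<^sub>R P x + s *\<^sub>R K x) \<bullet> (y + (c - 1) *\<^sub>R P y + s *\<^sub>R K y)
      = x \<bullet> y + D * (c\<^sup>2 + s\<^sup>2 - 1)" for c s :: real
    unfolding inner_add_left inner_add_right inner_scaleR_left inner_scaleR_right D E
    by (simp add: algebra_simps power2_eq_square)
  show ?thesis using expand[of "cos t" "sin t"] by (simp add: G_def P_def K_def)
qed

text \<open>At 0 the cosine is stationary and the sine has slope 1, so the derivative of
  \<open>f\<close> along the curve is \<open>c2\<close>.\<close>

lemma critical_point_on_circle:
  fixes f :: "'a::real_normed_vector \<Rightarrow> real"
  assumes crit: "critical_point_on f M Z"
    and M: "\<And>t. Z + (cos t - 1) *\<^sub>R P + sin t *\<^sub>R K \<in> M"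
    and f: "\<And>t. f (Z + (cos t - 1) *\<^sub>R P + sin t *\<^sub>R K) = c0 + (cos t - 1) * c1 + sin t * c2"
  shows "c2 = 0"
proof -
  define \<gamma> where "\<gamma> t = Z + (cos t - 1) *\<^sub>R P + sin t *\<^sub>R K" for t
  have "\<gamma> differentiable (at 0)"
    unfolding \<gamma>_def by (rule differentiableI_vector) (auto intro!: derivative_eq_intros)
  then have "((f \<circ> \<gamma>) has_real_derivative 0) (at 0)"
    using crit M unfolding critical_point_on_def
    by (elim conjE allE[of _ \<gamma>] allE[of _ 1]) (simp add: \<gamma>_def)
  moreover have "((f \<circ> \<gamma>) has_real_derivative c2) (at 0)"
    unfolding comp_def \<gamma>_def f by (auto intro!: derivative_eq_intros)
  ultimately show ?thesis using DERIV_unique by blast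
qed

lemma unit_curve_derivative_orthogonal:
  fixes c :: "real \<Rightarrow> 'a::real_inner"
  assumes c: "(c has_vector_derivative c') (at 0)" and "0 < \<epsilon>" and unit: "\<And>t. \<bar>t\<bar> < \<epsilon> \<Longrightarrow> c t \<bullet> c t = 1"
  shows "c 0 \<bullet> c' = 0"
proof -
  have "((\<lambda>t. c t \<bullet> c t) has_real_derivative c 0 \<bullet> c' + c' \<bullet> c 0) (at 0)"
    unfolding has_real_derivative_iff_has_vector_derivative
    by (rule bounded_bilinear.has_vector_derivative[OF bounded_bilinear_inner c c])
  then have "c 0 \<bullet> c' + c' \<bullet> c 0 = 0"
    by (rule DERIV_local_const[OF _ assms(2)]) (use assms(2) unit in auto)
  then show ?thesis by (simp add: inner_commute)
qed

text \<open>The residual \<open>r\<close> is orthogonal to every \<open>u j\<close>, so after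
  normalization it qualifies as \<open>b\<close> and is orthogonal to \<open>w i\<close> too. Being
  a combination of \<open>w i\<close> and \<open>u i\<close>, it is orthogonal to itself.\<close>

lemma orthonormal_component_eq:
  fixes u w :: "'p \<Rightarrow> 'a::real_inner"
  assumes u: "orthonormal_on UNIV u"
    and perp: "\<And>b i. norm b = 1 \<Longrightarrow> (\<And>j. b \<bullet> u j = 0) \<Longrightarrow> b \<bullet> w i = 0"
    and off: "\<And>i j. i \<noteq> j \<Longrightarrow> u j \<bullet> w i = 0"
  shows "w i = (u i \<bullet> w i) *\<^sub>R u i"
proof (rule ccontr)
  define r where "r = w i - (u i \<bullet> w i) *\<^sub>R u i"
  assume "w i \<noteq> (u i \<bullet> w i) *\<^sub>R u i"
  then have r0: "r \<noteq> 0" by (simp add: r_def)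
  have ru: "r \<bullet> u j = 0" for j
    using off[of i j] orthonormal_onD[OF u, of i j]
    by (cases "i = j") (auto simp: r_def inner_diff_left inner_diff_right inner_commute)
  have "(r /\<^sub>R norm r) \<bullet> w i = 0" using r0 ru by (intro perp) auto
  then have "r \<bullet> w i = 0" using r0 by simp
  then have "r \<bullet> r = 0" using ru[of i] by (simp add: r_def inner_diff_right inner_commute)
  with r0 show False by simp
qed

section \<open>Whitening\<close>

lemma triple_matrix_product_component:
  fixes U :: "real^'p^'m" and V :: "real^'q^'k"
  shows "(transpose U ** M ** V) $ i $ j = column i U \<bullet> (M *v column j V)"
proof -
  have "(transpose U ** (M ** V)) $ i $ j = column i U \<bullet> column j (M ** V)"
    by (simp add: matrix_matrix_mult_def transpose_def column_def inner_vec_def)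
  then show ?thesis by (simp add: column_matrix_matrix_mult matrix_mul_assoc)
qed

text \<open>\<open>S\<close> is the square of the symmetric matrix \<open>msqrt S\<close>, so one
  factor can be moved to each side of the inner product.\<close>

lemma pos_def_mat_congruence_orthonormal:
  fixes U :: "real^'p^'m"
  assumes "pos_def_mat S"
  shows "transpose U ** S ** U = mat 1 \<longleftrightarrow> orthonormal_on UNIV (\<lambda>i. msqrt S *v column i U)"
proof -
  have "column i U \<bullet> (S *v column j U) = (msqrt S *v column i U) \<bullet> (msqrt S *v column j U)" for i j
    using msqrt_pos_def(1,2)[OF assms]
    by (metis inner_symmetric_matrix matrix_vector_mul_assoc)
  then show ?thesis
    by (simp add: vec_eq_iff triple_matrix_product_component orthonormal_on_def mat_def)
qed

lemma bounded_linear_column_image: "bounded_linear (\<lambda>U::real^'p^'m. (A::real^'m^'k) *v column i U)"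
proof (rule linear_conv_bounded_linear[THEN iffD1], rule linearI)
  show "A *v column i (U + V) = A *v column i U + A *v column i V" for U V :: "real^'p^'m"
    by (simp add: column_def vec_eq_iff matrix_vector_mult_def sum.distrib algebra_simps)
  show "A *v column i (c *\<^sub>R U) = c *\<^sub>R (A *v column i U)" for c and U :: "real^'p^'m"
    by (simp add: column_def vec_eq_iff matrix_vector_mult_def sum_distrib_left mult_ac)
qed

definition cols :: "('p \<Rightarrow> real^'m) \<Rightarrow> real^'p^'m" where
  "cols u = (\<chi> r i. u i $ r)"

lemma column_cols [simp]: "column i (cols u) = u i"
  by (simp add: cols_def column_def vec_eq_iff)

lemma matrix_eq_columns: "U = V" if "\<And>i. column i U = column i V" for U V :: "real^'p^'m"
  using that by (simp add: column_def vec_eq_iff)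

text \<open>The assumptions are symmetric in the two data sets, so the locale can be interpreted a
  second time with them exchanged.\<close>

locale cca =
  fixes X :: "real^'dx^'n" and Y :: "real^'dy^'n" and lx ly :: real
    and \<mu> :: "'p::{finite,linorder} \<Rightarrow> real"
  assumes pos_def_x: "pos_def_mat (Sxx X lx)" and pos_def_y: "pos_def_mat (Sxx Y ly)"
    and card_x: "CARD('p) \<le> CARD('dx)" and card_y: "CARD('p) \<le> CARD('dy)"
    and \<mu>_decreasing: "\<And>i j. i < j \<Longrightarrow> \<mu> j < \<mu> i" and \<mu>_pos: "\<And>i. 0 < \<mu> i"
begin

abbreviation "f \<equiv> fCCA X Y \<mu>"
abbreviation "M \<equiv> Sset X Y lx ly :: ((real^('p::{finite,linorder})^'dx) \<times> (real^('p::{finite,linorder})^'dy)) set"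
abbreviation "R \<equiv> Rmat X Y lx ly"
abbreviation "\<sigma> \<equiv> sigma R"
abbreviation "wx U i \<equiv> msqrt (Sxx X lx) *v column i U"
abbreviation "wy V i \<equiv> msqrt (Sxx Y ly) *v column i V"

lemma msqrt_minvsqrt [simp]:
  "msqrt (Sxx X lx) *v (minvsqrt (Sxx X lx) *v x) = x"
  "msqrt (Sxx Y ly) *v (minvsqrt (Sxx Y ly) *v y) = y"
  "minvsqrt (Sxx X lx) *v (msqrt (Sxx X lx) *v x) = x"
  "minvsqrt (Sxx Y ly) *v (msqrt (Sxx Y ly) *v y) = y"
  by (simp_all add: matrix_vector_mul_assoc msqrt_pos_def[OF pos_def_x] msqrt_pos_def[OF pos_def_y])

lemma Sset_iff: "(U, V) \<in> M \<longleftrightarrow> orthonormal_on UNIV (wx U) \<and> orthonormal_on UNIV (wy V)"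
  by (simp add: Sset_def pos_def_mat_congruence_orthonormal pos_def_x pos_def_y)

lemma inner_R_whitened: "wx U i \<bullet> (R *v wy V i) = column i U \<bullet> (Sxy X Y *v column i V)"
  by (simp add: Rmat_def inner_symmetric_matrix[OF msqrt_pos_def(1)[OF pos_def_x]]
      flip: matrix_vector_mul_assoc)

lemma fCCA_whitened: "f (U, V) = - (\<Sum>i\<in>UNIV. \<mu> i * (wx U i \<bullet> (R *v wy V i)))"
  unfolding fCCA_def trace_def inner_R_whitened fst_conv snd_conv
  by (simp add: triple_matrix_product_component column_diagm vector_scalar_commute scalar_mult_eq_scaleR
      matrix_vector_mult_scaleR flip: matrix_mul_assoc[of _ V])

lemma inner_transpose_R: "(transpose R *v x) \<bullet> y = x \<bullet> (R *v y)"
  by (metis dot_lmul_matrix transpose_matrix_vector)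

lemma coord_col_iff: "coord_col X Y lx ly U V i \<beta> \<longleftrightarrow>
    R *v wy V i = \<beta> *\<^sub>R wx U i \<and> transpose R *v wx U i = \<beta> *\<^sub>R wy V i"
  by (simp add: coord_col_def scalar_mult_eq_scaleR Let_def)

lemma coord_col_coefficient:
  assumes "(U, V) \<in> M" "coord_col X Y lx ly U V i \<beta>"
  shows "\<beta> = wx U i \<bullet> (R *v wy V i)"
  using assms orthonormal_onD[of UNIV "wx U" i i] by (simp add: coord_col_iff Sset_iff)

section \<open>Critical points and coordinated pairs\<close>

lemma objective_along_curve:
  assumes "\<gamma> differentiable (at 0)" and "\<gamma> 0 = (U, V)"
  obtains u' v' where
    "\<And>i. ((\<lambda>t. wx (fst (\<gamma> t)) i) has_vector_derivative u' i) (at 0)"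
    "\<And>i. ((\<lambda>t. wy (snd (\<gamma> t)) i) has_vector_derivative v' i) (at 0)"
    "((f \<circ> \<gamma>) has_real_derivative
       - (\<Sum>i\<in>UNIV. \<mu> i * (wx U i \<bullet> (R *v v' i) + u' i \<bullet> (R *v wy V i)))) (at 0)"
proof -
  obtain d where d: "(\<gamma> has_vector_derivative d) (at 0)"
    using assms(1) vector_derivative_works by blast
  define u' where "u' i = wx (fst d) i" for i
  define v' where "v' i = wy (snd d) i" for i
  have u': "((\<lambda>t. wx (fst (\<gamma> t)) i) has_vector_derivative u' i) (at 0)" for i
    unfolding u'_def
    by (rule bounded_linear.has_vector_derivative[OF bounded_linear_column_image
          bounded_linear.has_vector_derivative[OF bounded_linear_fst d]])
  have v': "((\<lambda>t. wy (snd (\<gamma> t)) i) has_vector_derivative v' i) (at 0)" for i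
    unfolding v'_def
    by (rule bounded_linear.has_vector_derivative[OF bounded_linear_column_image
          bounded_linear.has_vector_derivative[OF bounded_linear_snd d]])
  have Rv': "((\<lambda>t. R *v wy (snd (\<gamma> t)) i) has_vector_derivative R *v v' i) (at 0)" for i
    by (rule bounded_linear.has_vector_derivative[OF matrix_vector_mul_bounded_linear v'])
  have d: "((\<lambda>t. wx (fst (\<gamma> t)) i \<bullet> (R *v wy (snd (\<gamma> t)) i)) has_real_derivative
      wx U i \<bullet> (R *v v' i) + u' i \<bullet> (R *v wy V i)) (at 0)" for i
    using bounded_bilinear.has_vector_derivative[OF bounded_bilinear_inner u' Rv'] assms(2)
    by (simp add: has_real_derivative_iff_has_vector_derivative)
  have eq: "f \<circ> \<gamma> = (\<lambda>t. - (\<Sum>i\<in>UNIV. \<mu> i * (wx (fst (\<gamma> t)) i \<bullet> (R *v wy (snd (\<gamma> t)) i))))"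
    using fCCA_whitened[of "fst (\<gamma> t)" "snd (\<gamma> t)" for t] by (simp add: fun_eq_iff)
  have "((f \<circ> \<gamma>) has_real_derivative
      - (\<Sum>i\<in>UNIV. \<mu> i * (wx U i \<bullet> (R *v v' i) + u' i \<bullet> (R *v wy V i)))) (at 0)"
    unfolding eq by (intro DERIV_minus DERIV_sum DERIV_cmult d)
  with u' v' show thesis by (rule that)
qed

text \<open>The velocity of a unit vector is orthogonal to it, while R v_i and R^T u_i are parallel
  to u_i and v_i. Hence every summand of the derivative vanishes separately.\<close>

lemma coordinated_imp_critical:
  assumes UV: "(U, V) \<in> M" and coord: "coordinated X Y lx ly U V"
  shows "critical_point_on f M (U, V)"
  unfolding critical_point_on_def
proof (intro conjI UV allI impI)
  fix \<gamma> and \<epsilon> :: real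
  assume \<epsilon>: "0 < \<epsilon>" "\<forall>t. \<bar>t\<bar> < \<epsilon> \<longrightarrow> \<gamma> t \<in> M" and \<gamma>0: "\<gamma> 0 = (U, V)"
    and diff: "\<gamma> differentiable (at 0)"
  obtain u' v' where
    u': "\<And>i. ((\<lambda>t. wx (fst (\<gamma> t)) i) has_vector_derivative u' i) (at 0)" and
    v': "\<And>i. ((\<lambda>t. wy (snd (\<gamma> t)) i) has_vector_derivative v' i) (at 0)" and
    f': "((f \<circ> \<gamma>) has_real_derivative
       - (\<Sum>i\<in>UNIV. \<mu> i * (wx U i \<bullet> (R *v v' i) + u' i \<bullet> (R *v wy V i)))) (at 0)"
    by (rule objective_along_curve[OF diff \<gamma>0]) (rule that)
  have orth: "orthonormal_on UNIV (wx (fst (\<gamma> t)))" "orthonormal_on UNIV (wy (snd (\<gamma> t)))"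
    if "\<bar>t\<bar> < \<epsilon>" for t
    using \<epsilon>(2) that Sset_iff[of "fst (\<gamma> t)" "snd (\<gamma> t)"] by auto
  have perp: "wx U i \<bullet> u' i = 0" "wy V i \<bullet> v' i = 0" for i
    using unit_curve_derivative_orthogonal[OF u' \<epsilon>(1)] unit_curve_derivative_orthogonal[OF v' \<epsilon>(1)]
      orthonormal_onD[OF orth(1)] orthonormal_onD[OF orth(2)] \<gamma>0 by auto
  have "wx U i \<bullet> (R *v v' i) + u' i \<bullet> (R *v wy V i) = 0" for i
  proof -
    obtain \<beta> where "R *v wy V i = \<beta> *\<^sub>R wx U i" "transpose R *v wx U i = \<beta> *\<^sub>R wy V i"
      using coord by (auto simp: coordinated_def coord_col_iff)
    then show ?thesis
      using perp[of i] by (simp add: inner_commute flip: inner_transpose_R)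
  qed
  with f' show "((f \<circ> \<gamma>) has_real_derivative 0) (at 0)" by simp
qed

text \<open>Up to sign, the left-hand side is the derivative of the objective when the whitened
  columns of \<open>U\<close> rotate in the plane of \<open>a\<close> and \<open>b\<close> and
  \<open>V\<close> stays fixed.\<close>

lemma critical_imp_skew_relation:
  assumes crit: "critical_point_on f M (U, V)"
    and ab: "a \<bullet> a = 1" "b \<bullet> b = 1" "a \<bullet> b = 0"
  shows "(\<Sum>i\<in>UNIV. \<mu> i * ((a \<bullet> wx U i) * (b \<bullet> (R *v wy V i)) - (b \<bullet> wx U i) * (a \<bullet> (R *v wy V i)))) = 0"
proof -
  have orth: "orthonormal_on UNIV (wx U)" "orthonormal_on UNIV (wy V)"
    using crit by (auto simp: critical_point_on_def Sset_iff)
  define P where "P x = (a \<bullet> x) *\<^sub>R a + (b \<bullet> x) *\<^sub>R b" for x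
  define K where "K x = (a \<bullet> x) *\<^sub>R b - (b \<bullet> x) *\<^sub>R a" for x
  \<comment> \<open>\<open>P'\<close> and \<open>K'\<close> are chosen so that whitening turns their
    columns into \<open>P (wx U i)\<close> and \<open>K (wx U i)\<close>.\<close>
  define P' :: "real^('p::{finite,linorder})^'dx" where "P' = cols (\<lambda>i. minvsqrt (Sxx X lx) *v P (wx U i))"
  define K' :: "real^('p::{finite,linorder})^'dx" where "K' = cols (\<lambda>i. minvsqrt (Sxx X lx) *v K (wx U i))"
  have curve: "(U, V) + (cos t - 1) *\<^sub>R (P', 0) + sin t *\<^sub>R (K', 0)
      = (U + (cos t - 1) *\<^sub>R P' + sin t *\<^sub>R K', V)" for t by simp
  have w: "wx (U + (cos t - 1) *\<^sub>R P' + sin t *\<^sub>R K') i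
      = wx U i + (cos t - 1) *\<^sub>R P (wx U i) + sin t *\<^sub>R K (wx U i)" for t i
  proof -
    interpret bounded_linear "\<lambda>U::real^('p::{finite,linorder})^'dx. wx U i" by (rule bounded_linear_column_image)
    show ?thesis by (simp add: add scaleR P'_def K'_def)
  qed
  have "- (\<Sum>i\<in>UNIV. \<mu> i * (K (wx U i) \<bullet> (R *v wy V i))) = 0"
  proof (rule critical_point_on_circle[OF crit])
    show "(U, V) + (cos t - 1) *\<^sub>R (P', 0) + sin t *\<^sub>R (K', 0) \<in> M" for t
      using orth rotation_preserves_inner[OF ab, of _ t]
      unfolding curve Sset_iff w orthonormal_on_def P_def K_def by simp
    show "f ((U, V) + (cos t - 1) *\<^sub>R (P', 0) + sin t *\<^sub>R (K', 0))
        = - (\<Sum>i\<in>UNIV. \<mu> i * (wx U i \<bullet> (R *v wy V i)))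
          + (cos t - 1) * - (\<Sum>i\<in>UNIV. \<mu> i * (P (wx U i) \<bullet> (R *v wy V i)))
          + sin t * - (\<Sum>i\<in>UNIV. \<mu> i * (K (wx U i) \<bullet> (R *v wy V i)))" for t
      unfolding curve fCCA_whitened w
      by (simp add: inner_add_left distrib_left sum.distrib sum_distrib_left mult_ac)
  qed
  then show ?thesis by (simp add: K_def inner_diff_left)
qed

text \<open>Rotating u_i towards \<open>b\<close> moves no other column to first order, so the sum
  has one term, with positive weight.\<close>

lemma critical_imp_orthogonal:
  assumes crit: "critical_point_on f M (U, V)" and b: "norm b = 1" "\<And>j. b \<bullet> wx U j = 0"
  shows "b \<bullet> (R *v wy V i) = 0"
proof -
  have u: "orthonormal_on UNIV (wx U)"
    using crit by (auto simp: critical_point_on_def Sset_iff)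
  have "(\<Sum>j\<in>UNIV. \<mu> j * ((wx U i \<bullet> wx U j) * (b \<bullet> (R *v wy V j)) - (b \<bullet> wx U j) * (wx U i \<bullet> (R *v wy V j)))) = 0"
    using b orthonormal_onD[OF u] by (intro critical_imp_skew_relation[OF crit]) (auto simp: norm_eq_1 inner_commute)
  also have "(\<lambda>j. \<mu> j * ((wx U i \<bullet> wx U j) * (b \<bullet> (R *v wy V j)) - (b \<bullet> wx U j) * (wx U i \<bullet> (R *v wy V j))))
      = (\<lambda>j. if i = j then \<mu> i * (b \<bullet> (R *v wy V i)) else 0)"
    by (auto simp: fun_eq_iff b(2) orthonormal_onD[OF u])
  finally show ?thesis using \<mu>_pos[of i] by simp
qed

lemma critical_imp_exchange:
  assumes crit: "critical_point_on f M (U, V)" and ik: "i \<noteq> k"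
  shows "\<mu> i * (wx U k \<bullet> (R *v wy V i)) = \<mu> k * (wx U i \<bullet> (R *v wy V k))"
proof -
  have u: "orthonormal_on UNIV (wx U)"
    using crit by (auto simp: critical_point_on_def Sset_iff)
  have "(\<Sum>j\<in>UNIV. \<mu> j * ((wx U i \<bullet> wx U j) * (wx U k \<bullet> (R *v wy V j)) - (wx U k \<bullet> wx U j) * (wx U i \<bullet> (R *v wy V j)))) = 0"
    using orthonormal_onD[OF u] ik by (intro critical_imp_skew_relation[OF crit]) auto
  also have "(\<lambda>j. \<mu> j * ((wx U i \<bullet> wx U j) * (wx U k \<bullet> (R *v wy V j)) - (wx U k \<bullet> wx U j) * (wx U i \<bullet> (R *v wy V j))))
      = (\<lambda>j. (if i = j then \<mu> i * (wx U k \<bullet> (R *v wy V i)) else 0) - (if k = j then \<mu> k * (wx U i \<bullet> (R *v wy V k)) else 0))"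
    using ik by (auto simp: fun_eq_iff orthonormal_onD[OF u])
  finally show ?thesis by (simp add: sum_subtractf)
qed

lemma Rmat_swap: "Rmat Y X ly lx = transpose R"
  by (simp add: Rmat_def Sxy_def matrix_transpose_mul matrix_mul_assoc
      msqrt_pos_def(5)[OF pos_def_x] msqrt_pos_def(5)[OF pos_def_y])

lemma swapped: "cca Y X ly lx \<mu>"
  using pos_def_x pos_def_y card_x card_y \<mu>_decreasing \<mu>_pos by unfold_locales

text \<open>Exchanging the components of a curve preserves feasibility, differentiability and the
  objective. This transfers the relations for the family u to the family v.\<close>

lemma critical_swap:
  assumes crit: "critical_point_on f M (U, V)"
  shows "critical_point_on (fCCA Y X \<mu>) (Sset Y X ly lx) (V, U)"
  unfolding critical_point_on_def
proof (intro conjI allI impI)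
  interpret S: cca Y X ly lx \<mu> by (rule swapped)
  have Sset_swap: "(U, V) \<in> M \<longleftrightarrow> (V, U) \<in> S.M" for U V by (auto simp: Sset_def)
  have f_swap: "f (U, V) = fCCA Y X \<mu> (V, U)" for U V
    unfolding fCCA_whitened S.fCCA_whitened Rmat_swap by (simp add: inner_commute flip: inner_transpose_R)
  show "(V, U) \<in> S.M" using crit Sset_swap by (simp add: critical_point_on_def)
  fix \<gamma> and \<epsilon> :: real
  assume \<gamma>: "0 < \<epsilon>" "\<forall>t. \<bar>t\<bar> < \<epsilon> \<longrightarrow> \<gamma> t \<in> S.M" "\<gamma> 0 = (V, U)" "\<gamma> differentiable (at 0)"
  define \<delta> where "\<delta> t = (snd (\<gamma> t), fst (\<gamma> t))" for t
  obtain d where d: "(\<gamma> has_derivative d) (at 0)" using \<gamma>(4) by (auto simp: differentiable_def)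
  have "(\<delta> has_derivative (\<lambda>t. (snd (d t), fst (d t)))) (at 0)"
    unfolding \<delta>_def by (intro has_derivative_Pair has_derivative_snd has_derivative_fst d)
  then have "\<delta> differentiable (at 0)" by (auto simp: differentiable_def)
  moreover have "\<forall>t. \<bar>t\<bar> < \<epsilon> \<longrightarrow> \<delta> t \<in> M"
    using \<gamma>(2) Sset_swap by (simp add: \<delta>_def)
  moreover have "\<delta> 0 = (U, V)" by (simp add: \<delta>_def \<gamma>(3))
  ultimately have "((f \<circ> \<delta>) has_real_derivative 0) (at 0)"
    using crit \<gamma>(1) by (simp add: critical_point_on_def)
  moreover have "f \<circ> \<delta> = fCCA Y X \<mu> \<circ> \<gamma>" by (simp add: fun_eq_iff \<delta>_def f_swap)
  ultimately show "((fCCA Y X \<mu> \<circ> \<gamma>) has_real_derivative 0) (at 0)" by simp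
qed

lemma critical_imp_coordinated:
  assumes crit: "critical_point_on f M (U, V)"
  shows "coordinated X Y lx ly U V"
proof -
  interpret S: cca Y X ly lx \<mu> by (rule swapped)
  have crit': "critical_point_on (fCCA Y X \<mu>) S.M (V, U)" by (rule critical_swap[OF crit])
  have u: "orthonormal_on UNIV (wx U)" and v: "orthonormal_on UNIV (wy V)"
    using crit by (auto simp: critical_point_on_def Sset_iff)
  have off: "wx U k \<bullet> (R *v wy V i) = 0" if ik: "i \<noteq> k" for i k
  proof -
    define x where "x = wx U k \<bullet> (R *v wy V i)"
    define y where "y = wx U i \<bullet> (R *v wy V k)"
    have 1: "\<mu> i * x = \<mu> k * y"
      unfolding x_def y_def by (rule critical_imp_exchange[OF crit ik])
    \<comment> \<open>In the exchanged problem R is transposed, so the same two entries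
      \<open>x\<close> and \<open>y\<close> appear with their weights interchanged.\<close>
    have 2: "\<mu> i * y = \<mu> k * x"
      using S.critical_imp_exchange[OF crit' ik]
      by (simp add: Rmat_swap x_def y_def inner_commute[of "wy V _"] inner_transpose_R
          del: transpose_matrix_vector)
    have "(\<mu> i * \<mu> i - \<mu> k * \<mu> k) * x = \<mu> i * (\<mu> i * x) - \<mu> k * (\<mu> k * x)"
      by (simp add: algebra_simps)
    also have "\<dots> = 0" unfolding 1 2[symmetric] by (simp add: algebra_simps)
    finally have "(\<mu> i - \<mu> k) * (\<mu> i + \<mu> k) * x = 0" by (simp add: algebra_simps)
    moreover have "\<mu> i \<noteq> \<mu> k" using ik \<mu>_decreasing by (metis less_irrefl neq_iff)
    moreover have "\<mu> i + \<mu> k \<noteq> 0" using \<mu>_pos[of i] \<mu>_pos[of k] by simp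
    ultimately show ?thesis by (simp add: x_def)
  qed
  have "R *v wy V i = (wx U i \<bullet> (R *v wy V i)) *\<^sub>R wx U i" for i
    by (rule orthonormal_component_eq[OF u critical_imp_orthogonal[OF crit] off])
  moreover have "transpose R *v wx U i = (wx U i \<bullet> (R *v wy V i)) *\<^sub>R wy V i" for i
  proof -
    have "transpose R *v wx U i = (wy V i \<bullet> (transpose R *v wx U i)) *\<^sub>R wy V i"
    proof (rule orthonormal_component_eq[OF v])
      show "b \<bullet> (transpose R *v wx U i) = 0" if "norm b = 1" "\<And>j. b \<bullet> wy V j = 0" for b i
        using S.critical_imp_orthogonal[OF crit' that] by (simp add: Rmat_swap)
      show "wy V j \<bullet> (transpose R *v wx U i) = 0" if "i \<noteq> j" for i j
        using off[of j i] that by (simp add: inner_commute[of "wy V _"] inner_transpose_R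
          del: transpose_matrix_vector)
    qed
    \<comment> \<open>The adjoint relation turns the coefficient into <u_i, R v_i>, giving both
      singular vector equations the same factor.\<close>
    then show ?thesis unfolding inner_commute[of "wy V _"] inner_transpose_R .
  qed
  ultimately show ?thesis unfolding coordinated_def coord_col_iff by blast
qed

section \<open>Minimizers\<close>

text \<open>The weighted Ky Fan bound is attained at \<open>(U0, V0)\<close>, obtained from top
  singular vectors by undoing the whitening. Minimizers are therefore its equality cases.\<close>

lemma minimizer_iff:
  assumes UV: "(U, V) \<in> M"
  shows "minimizer_on f M (U, V) \<longleftrightarrow> (\<forall>i. wx U i \<bullet> (R *v wy V i) = \<sigma> (col_pos i))"
proof -
  obtain q where "singular_system ((*v) R) \<sigma> q" by (rule singular_system_sigma)
  then interpret S: singular_system "(*v) R" \<sigma> q .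
  have lower: "- (\<Sum>i\<in>UNIV. \<mu> i * \<sigma> (col_pos i)) \<le> f (U, V)" if "(U, V) \<in> M" for U V
    using S.weighted_ky_fan(1)[of \<mu> "wx U" "wy V", OF \<mu>_decreasing \<mu>_pos] that
    by (simp add: fCCA_whitened Sset_iff)
  obtain u :: "'p \<Rightarrow> real^'dx" and v :: "'p \<Rightarrow> real^'dy" where
    uv: "orthonormal_on UNIV u" "orthonormal_on UNIV v" "\<forall>i. u i \<bullet> (R *v v i) = \<sigma> (col_pos i)"
    using S.top_singular_vectors_exist[where 'p = 'p] card_x card_y by auto
  define U0 where "U0 = cols (\<lambda>i. minvsqrt (Sxx X lx) *v u i)"
  define V0 where "V0 = cols (\<lambda>i. minvsqrt (Sxx Y ly) *v v i)"
  have 0: "(U0, V0) \<in> M" "f (U0, V0) = - (\<Sum>i\<in>UNIV. \<mu> i * \<sigma> (col_pos i))"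
    using uv by (simp_all add: U0_def V0_def Sset_iff fCCA_whitened)
  show ?thesis
  proof
    assume "minimizer_on f M (U, V)"
    then have "f (U, V) \<le> f (U0, V0)" using 0(1) by (auto simp: minimizer_on_def)
    with lower[OF UV] 0(2) have "f (U, V) = - (\<Sum>i\<in>UNIV. \<mu> i * \<sigma> (col_pos i))" by linarith
    then have "(\<Sum>i\<in>UNIV. \<mu> i * (wx U i \<bullet> (R *v wy V i))) = (\<Sum>i\<in>UNIV. \<mu> i * \<sigma> (col_pos i))"
      by (simp add: fCCA_whitened)
    then show "\<forall>i. wx U i \<bullet> (R *v wy V i) = \<sigma> (col_pos i)"
      using S.weighted_ky_fan(2)[of \<mu> "wx U" "wy V", OF \<mu>_decreasing \<mu>_pos] UV
      by (simp add: Sset_iff)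
  next
    assume "\<forall>i. wx U i \<bullet> (R *v wy V i) = \<sigma> (col_pos i)"
    then have "f (U, V) = - (\<Sum>i\<in>UNIV. \<mu> i * \<sigma> (col_pos i))" by (simp add: fCCA_whitened)
    with lower UV show "minimizer_on f M (U, V)" by (auto simp: minimizer_on_def)
  qed
qed

lemma minimizer_imp_critical:
  assumes "minimizer_on f M (U, V)"
  shows "critical_point_on f M (U, V)"
  unfolding critical_point_on_def
proof (intro conjI allI impI)
  show "(U, V) \<in> M" using assms by (simp add: minimizer_on_def)
  fix \<gamma> and \<epsilon> :: real
  assume \<gamma>: "0 < \<epsilon>" "\<forall>t. \<bar>t\<bar> < \<epsilon> \<longrightarrow> \<gamma> t \<in> M" "\<gamma> 0 = (U, V)" "\<gamma> differentiable (at 0)"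
  obtain D where D: "((f \<circ> \<gamma>) has_real_derivative D) (at 0)"
    by (rule objective_along_curve[OF \<gamma>(4,3)]) (rule that)
  have "D = 0"
    using assms \<gamma> by (intro DERIV_local_min[OF D \<gamma>(1)]) (auto simp: minimizer_on_def)
  with D show "((f \<circ> \<gamma>) has_real_derivative 0) (at 0)" by simp
qed

lemma same_phase_iff: "same_phase X Y U V \<longleftrightarrow> (\<forall>i. 0 \<le> wx U i \<bullet> (R *v wy V i))"
  unfolding same_phase_def inner_R_whitened by (simp add: Sxy_def)

lemma sigma_nonneg: "0 \<le> \<sigma> k"
proof -
  obtain q where "singular_system ((*v) R) \<sigma> q" by (rule singular_system_sigma)
  then show ?thesis by (rule singular_system.nonneg)
qed

text \<open>Criticality provides some coefficient, and the equality case of the bound identifies it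
  as the singular value, sign included.\<close>

lemma minimizer_coord_col:
  assumes "minimizer_on f M (U, V)"
  shows "coord_col X Y lx ly U V i (\<sigma> (col_pos i))"
proof -
  have UV: "(U, V) \<in> M" using assms by (simp add: minimizer_on_def)
  obtain \<beta> where \<beta>: "coord_col X Y lx ly U V i \<beta>"
    using critical_imp_coordinated[OF minimizer_imp_critical[OF assms]] by (auto simp: coordinated_def)
  have "\<beta> = \<sigma> (col_pos i)"
    using coord_col_coefficient[OF UV \<beta>] assms minimizer_iff[OF UV] by simp
  with \<beta> show ?thesis by simp
qed

lemma minimizer_iff_top:
  assumes UV: "(U, V) \<in> M"
  shows "minimizer_on f M (U, V) \<longleftrightarrow>
    critical_point_on f M (U, V) \<and> coordinated_top X Y lx ly U V \<and> same_phase X Y U V"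
proof
  assume min: "minimizer_on f M (U, V)"
  have "coordinated_top X Y lx ly U V"
    unfolding coordinated_top_def using minimizer_coord_col[OF min] sigma_nonneg
    by (metis abs_of_nonneg)
  moreover have "same_phase X Y U V"
    using min minimizer_iff[OF UV] sigma_nonneg by (simp add: same_phase_iff)
  ultimately show "critical_point_on f M (U, V) \<and> coordinated_top X Y lx ly U V \<and> same_phase X Y U V"
    using minimizer_imp_critical[OF min] by blast
next
  assume "critical_point_on f M (U, V) \<and> coordinated_top X Y lx ly U V \<and> same_phase X Y U V"
  then have top: "coordinated_top X Y lx ly U V" and phase: "same_phase X Y U V" by auto
  have "wx U i \<bullet> (R *v wy V i) = \<sigma> (col_pos i)" for i
  proof -
    obtain \<beta> where \<beta>: "coord_col X Y lx ly U V i \<beta>" "\<bar>\<beta>\<bar> = \<sigma> (col_pos i)"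
      using top by (auto simp: coordinated_top_def)
    have "\<beta> = wx U i \<bullet> (R *v wy V i)" by (rule coord_col_coefficient[OF UV \<beta>(1)])
    \<comment> \<open>The phase condition fixes the sign that the absolute value in
      \<open>coordinated_top\<close> leaves open.\<close>
    moreover from this have "0 \<le> \<beta>" using phase by (simp add: same_phase_iff)
    ultimately show ?thesis using \<beta>(2) by simp
  qed
  then show "minimizer_on f M (U, V)" using minimizer_iff[OF UV] by blast
qed

section \<open>Uniqueness up to signs\<close>

lemma minimizers_differ_by_signs:
  assumes gap: "\<And>k. k < CARD('p) \<Longrightarrow> \<sigma> (Suc k) < \<sigma> k"
    and min: "minimizer_on f M (U, V)" "minimizer_on f M (U', V')"
  obtains t where "\<And>i. t i \<in> {-1, 1::real}" "U' = U ** diagm t" "V' = V ** diagm t"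
proof -
  obtain q where "singular_system ((*v) R) \<sigma> q" by (rule singular_system_sigma)
  then interpret S: singular_system "(*v) R" \<sigma> q .
  \<comment> \<open>The gap at the last column also separates the top values from every later one,
    including the padding zeros.\<close>
  have simple: "\<sigma> j \<noteq> \<sigma> i" if "i < CARD('p)" "j \<noteq> i" for i j
  proof (cases "j < i")
    case True
    then have "\<sigma> (i - 1) \<le> \<sigma> j" using S.decseq by (simp add: decseq_def)
    moreover have "\<sigma> i < \<sigma> (i - 1)" using gap[of "i - 1"] that True by simp
    ultimately show ?thesis by simp
  next
    case False
    then have "\<sigma> j \<le> \<sigma> (Suc i)" using that S.decseq by (simp add: decseq_def)
    with gap[OF that(1)] show ?thesis by simp
  qed
  \<comment> \<open>v_i is an eigenvector of R^T R for a simple eigenvalue, hence a unit vector on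
    the line of \<open>q\<close>.\<close>
  have right: "\<exists>a. wy V i = a *\<^sub>R q (col_pos i) \<and> a * a = 1"
    if "minimizer_on f M (U, V)" for U V i
  proof -
    have UV: "(U, V) \<in> M" using that by (simp add: minimizer_on_def)
    have c: "R *v wy V i = \<sigma> (col_pos i) *\<^sub>R wx U i" "transpose R *v wx U i = \<sigma> (col_pos i) *\<^sub>R wy V i"
      using minimizer_coord_col[OF that] by (simp_all add: coord_col_iff)
    have less: "col_pos i < DIM(real^'dy)" using col_pos_less[of i] card_y by simp
    have eq: "wy V i = (wy V i \<bullet> q (col_pos i)) *\<^sub>R q (col_pos i)"
    proof (rule S.simple_right_singular_vector[OF less])
      show "\<sigma> j \<noteq> \<sigma> (col_pos i)" if "j \<noteq> col_pos i" for j
        by (rule simple[OF col_pos_less that])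
      show "(R *v wy V i) \<bullet> (R *v y) = (\<sigma> (col_pos i))\<^sup>2 * (wy V i \<bullet> y)" for y
      proof -
        have "(R *v wy V i) \<bullet> (R *v y) = \<sigma> (col_pos i) * ((transpose R *v wx U i) \<bullet> y)"
          by (simp only: c(1) inner_transpose_R inner_scaleR_left)
        then show ?thesis by (simp only: c(2) inner_scaleR_left power2_eq_square mult.assoc)
      qed
    qed
    define a where "a = wy V i \<bullet> q (col_pos i)"
    have "wy V i \<bullet> wy V i = 1" using UV by (auto simp: Sset_iff orthonormal_on_def)
    moreover have "q (col_pos i) \<bullet> q (col_pos i) = 1" using orthonormal_onD[OF S.orthonormal] less by simp
    ultimately have "a * a = 1" using eq[folded a_def] by simp
    with eq[folded a_def] show ?thesis by blast
  qed
  have "\<exists>t. t \<in> {-1, 1} \<and> wx U' i = t *\<^sub>R wx U i \<and> wy V' i = t *\<^sub>R wy V i" for i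
  proof -
    obtain a where a: "wy V i = a *\<^sub>R q (col_pos i)" "a * a = 1" using right[OF min(1)] by blast
    obtain b where b: "wy V' i = b *\<^sub>R q (col_pos i)" "b * b = 1" using right[OF min(2)] by blast
    \<comment> \<open>As \<open>a * a = 1\<close>, multiplying by \<open>a\<close> recovers the
      common vector \<open>q\<close> from \<open>wy V i\<close>, and \<open>b\<close> leads on to
      \<open>wy V' i\<close>.\<close>
    define t where "t = a * b"
    have "t\<^sup>2 = (a * a) * (b * b)" by (simp add: t_def power2_eq_square)
    then have t: "t \<in> {-1, 1}" using a b by (auto simp: power2_eq_1_iff)
    have "t *\<^sub>R wy V i = (b * (a * a)) *\<^sub>R q (col_pos i)" by (simp add: a(1) t_def mult_ac)
    then have v: "wy V' i = t *\<^sub>R wy V i" by (simp add: a(2) b(1))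
    \<comment> \<open>Positivity lets u_i be recovered from R v_i by division, so the left vector
      carries the same sign \<open>t\<close> as the right one.\<close>
    have pos: "0 < \<sigma> (col_pos i)" using gap[OF col_pos_less[of i]] sigma_nonneg[of "Suc (col_pos i)"] by linarith
    have "\<sigma> (col_pos i) *\<^sub>R wx U' i = R *v wy V' i"
      using minimizer_coord_col[OF min(2)] by (simp add: coord_col_iff)
    also have "\<dots> = t *\<^sub>R (R *v wy V i)" by (simp add: v matrix_vector_mult_scaleR)
    also have "\<dots> = \<sigma> (col_pos i) *\<^sub>R (t *\<^sub>R wx U i)"
      using minimizer_coord_col[OF min(1)] by (simp add: coord_col_iff mult.commute)
    finally have "wx U' i = t *\<^sub>R wx U i" using pos by (metis scaleR_cancel_left less_irrefl)
    with t v show ?thesis by blast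
  qed
  then obtain t where t: "\<And>i. t i \<in> {-1, 1}" "\<And>i. wx U' i = t i *\<^sub>R wx U i" "\<And>i. wy V' i = t i *\<^sub>R wy V i"
    by metis
  have "column i U' = t i *\<^sub>R column i U" "column i V' = t i *\<^sub>R column i V" for i
    using arg_cong[OF t(2)[of i], of "(*v) (minvsqrt (Sxx X lx))"]
      arg_cong[OF t(3)[of i], of "(*v) (minvsqrt (Sxx Y ly))"]
    by (simp_all add: matrix_vector_mult_scaleR)
  then have "U' = U ** diagm t" "V' = V ** diagm t"
    by (auto intro!: matrix_eq_columns simp: column_diagm scalar_mult_eq_scaleR)
  with t(1) show thesis by (rule that)
qed

end

theorem theorem4p2:
  fixes X :: "real^'dx^'n" and Y :: "real^'dy^'n" and lx ly :: real
    and \<mu> :: "'p::{finite,linorder} \<Rightarrow> real"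
  assumes "0 \<le> lx" and "0 \<le> ly"
    and "pos_def_mat (Sxx X lx)" and "pos_def_mat (Sxx Y ly)"
    and "CARD('p) \<le> CARD('dx)" and "CARD('p) \<le> CARD('dy)"
    and "\<And>i j. i < j \<Longrightarrow> \<mu> j < \<mu> i" and "\<And>i. 0 < \<mu> i"
  shows "(\<forall>U V. (U, V) \<in> Sset X Y lx ly \<longrightarrow>
            (critical_point_on (fCCA X Y \<mu>) (Sset X Y lx ly) (U, V) \<longleftrightarrow> coordinated X Y lx ly U V))
       \<and> (\<forall>U V. (U, V) \<in> Sset X Y lx ly \<longrightarrow>
            (minimizer_on (fCCA X Y \<mu>) (Sset X Y lx ly) (U, V) \<longleftrightarrow>
               critical_point_on (fCCA X Y \<mu>) (Sset X Y lx ly) (U, V) \<and>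
               coordinated_top X Y lx ly U V \<and> same_phase X Y U V))
       \<and> ((\<forall>k < CARD('p). sigma (Rmat X Y lx ly) (Suc k) < sigma (Rmat X Y lx ly) k)
            \<and> 0 \<le> sigma (Rmat X Y lx ly) (CARD('p))
          \<longrightarrow> (\<forall>U V U' V'. minimizer_on (fCCA X Y \<mu>) (Sset X Y lx ly) (U, V) \<longrightarrow>
                 minimizer_on (fCCA X Y \<mu>) (Sset X Y lx ly) (U', V') \<longrightarrow>
                 (\<exists>s t. (\<forall>i. s i \<in> {-1, 1::real}) \<and> (\<forall>i. t i \<in> {-1, 1::real}) \<and>
                        U' = U ** diagm s \<and> V' = V ** diagm t)))"
proof -
  interpret cca X Y lx ly \<mu>
    using assms(3-) by unfold_locales
  show ?thesis
  proof (intro conjI allI impI)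
    fix U V assume UV: "(U, V) \<in> M"
    show "critical_point_on f M (U, V) \<longleftrightarrow> coordinated X Y lx ly U V"
      using critical_imp_coordinated coordinated_imp_critical[OF UV] by blast
    show "minimizer_on f M (U, V) \<longleftrightarrow>
        critical_point_on f M (U, V) \<and> coordinated_top X Y lx ly U V \<and> same_phase X Y U V"
      by (rule minimizer_iff_top[OF UV])
  next
    fix U V U' V'
    assume gap: "(\<forall>k<CARD('p). \<sigma> (Suc k) < \<sigma> k) \<and> 0 \<le> \<sigma> CARD('p)"
      and min: "minimizer_on f M (U, V)" "minimizer_on f M (U', V')"
    \<comment> \<open>One family of signs works for both matrices and instantiates both existential
      quantifiers.\<close>
    obtain t where "\<And>i. t i \<in> {-1, 1::real}" "U' = U ** diagm t" "V' = V ** diagm t"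
      using minimizers_differ_by_signs[OF _ min] gap by blast
    then show "\<exists>s t. (\<forall>i. s i \<in> {-1, 1::real}) \<and> (\<forall>i. t i \<in> {-1, 1::real}) \<and>
        U' = U ** diagm s \<and> V' = V ** diagm t" by blast
  qed
qed

end
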